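(* There is a universal constant $c>0$ (independent of all the objects below) such that the following holds. Let $n\in\mathbb{N}$, $n\ge 1$, let $\mathbf{X}=(X_1,\dots,X_n)$ be a vector of independent (not necessarily identically distributed) random variables with values in a space $\mathcal{X}$, let $\mathbf{X}'$ be an independent copy of $\mathbf{X}$ (independent of $\mathbf{X}$, with the same distribution as $\mathbf{X}$), and let $\mathcal{F}$ be a finite nonempty class of measurable functions $f:\mathcal{X}\to[0,1]$. Let $\Phi:\mathbb{R}^n\to\mathbb{R}$ be twice differentiable and let $L,M$ be real numbers such that $$\forall k\in\{1,\dots,n\}:\quad \|\partial_k\Phi\|_\infty\le L$$ and $$\sqrt{\sum_{k=1}^n\Big\|\sum_{l:\,l\ne k}(\partial_{lk}\Phi)^2\Big\|_\infty}\le M.$$ Then $$\mathbb{E}\,\sup_{f\in\mathcal{F}}\Big[\mathbb{E}\,\Phi(f(\mathbf{X}'))-\Phi(f(\mathbf{X}))\Big]\le c\,(M+L)\,\mathbb{E}\,G(\mathcal{F}(\mathbf{X})).$$ Furthermore, if $\delta>0$, then with probability at least $1-\delta$ in $\mathbf{X}$ it holds for all $f\in\mathcal{F}$ that $$\mathbb{E}\big[\Phi(f(\mathbf{X}'))\big]\le\Phi(f(\mathbf{X}))+c\,(L+M)\,\mathbb{E}\,G(\mathcal{F}(\mathbf{X}))+L\sqrt{\frac{n\ln(1/\delta)}{2}}.$$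
   Context: Notation. For $f:\mathcal{X}\to[0,1]$ and $\mathbf{x}=(x_1,\dots,x_n)\in\mathcal{X}^n$ write $f(\mathbf{x})=(f(x_1),\dots,f(x_n))\in\mathbb{R}^n$, and $\mathcal{F}(\mathbf{x})=\{f(\mathbf{x}):f\in\mathcal{F}\}\subseteq\mathbb{R}^n$. Thus $\mathcal{F}(\mathbf{X})$ is a random subset of $\mathbb{R}^n$. The space $\mathcal{X}$ is an arbitrary measurable space. For a set $Y\subseteq\mathbb{R}^n$ the Gaussian average is $G(Y)=\mathbb{E}\sup_{\mathbf{y}\in Y}\sum_{i=1}^n\gamma_i y_i$, where $\gamma_1,\dots,\gamma_n$ are independent standard normal random variables. In $\mathbb{E}\,G(\mathcal{F}(\mathbf{X}))$ the outer expectation is over $\mathbf{X}$, and $G(\mathcal{F}(\mathbf{X}))$ is the Gaussian average for fixed $\mathbf{X}$ (the $\gamma_i$ being independent of $\mathbf{X}$). For a twice differentiable function $\Phi$ on $\mathbb{R}^n$, $\partial_k\Phi$ is the partial derivative with respect to the $k$-th variable and $\partial_{lk}\Phi$ is the second partial derivative with respect to the $k$-th and $l$-th variables. For a real function $F$ on $\mathbb{R}^n$, $\|F\|_\infty=\sup_{\mathbf{s}\in\mathbb{R}^n}|F(\mathbf{s})|$. For $\delta\ge 1$ the probability assertion is understood to be vacuous. *)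

theory Defs
  imports "HOL-Probability.Probability"
begin

text \<open>The dimension \<open>n\<close> is quantified inside the theorem, so \<open>\<real>\<^sup>n\<close> is not a
  type here but the set of extensional functions on \<open>{1..n}\<close>, i.e. the carrier of the
  library's product measure \<open>PiM {1..n} (\<lambda>_. borel)\<close>.\<close>

definition Rn :: "nat \<Rightarrow> (nat \<Rightarrow> real) set" where
  "Rn n = {1..n} \<rightarrow>\<^sub>E UNIV"

definition map_vec :: "nat \<Rightarrow> ('x \<Rightarrow> real) \<Rightarrow> (nat \<Rightarrow> 'x) \<Rightarrow> (nat \<Rightarrow> real)" where
  "map_vec n f x = (\<lambda>i\<in>{1..n}. f (x i))"

definition class_image :: "nat \<Rightarrow> ('x \<Rightarrow> real) set \<Rightarrow> (nat \<Rightarrow> 'x) \<Rightarrow> (nat \<Rightarrow> real) set" where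
  "class_image n \<F> x = (\<lambda>f. map_vec n f x) ` \<F>"

text \<open>The vector of independent standard normal variables is modelled canonically, as the
  coordinates of the product of \<open>n\<close> standard normal laws. The supremum is a real one; below,
  \<open>Y\<close> is always finite and nonempty.\<close>

definition gaussian_average :: "nat \<Rightarrow> (nat \<Rightarrow> real) set \<Rightarrow> real" where
  "gaussian_average n Y =
     (\<integral>\<gamma>. (SUP y\<in>Y. \<Sum>i=1..n. \<gamma> i * y i)
        \<partial>(PiM {1..n} (\<lambda>_. density lborel (\<lambda>t. ennreal (std_normal_density t)))))"

definition partial :: "nat \<Rightarrow> ((nat \<Rightarrow> real) \<Rightarrow> real) \<Rightarrow> (nat \<Rightarrow> real) \<Rightarrow> real" where
  "partial k \<Phi> x = deriv (\<lambda>t. \<Phi> (x(k := t))) (x k)"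

text \<open>Frechet differentiability at \<open>x\<close> with respect to the Euclidean norm;
  \<open>g\<close> represents the derivative, a linear functional on \<open>\<real>\<^sup>n\<close>.\<close>

definition differentiable_Rn :: "nat \<Rightarrow> ((nat \<Rightarrow> real) \<Rightarrow> real) \<Rightarrow> (nat \<Rightarrow> real) \<Rightarrow> bool" where
  "differentiable_Rn n \<Phi> x \<longleftrightarrow>
     (\<exists>g :: nat \<Rightarrow> real. \<forall>\<epsilon>>0. \<exists>d>0. \<forall>y\<in>Rn n.
        L2_set (\<lambda>i. y i - x i) {1..n} < d \<longrightarrow>
        \<bar>\<Phi> y - \<Phi> x - (\<Sum>i=1..n. g i * (y i - x i))\<bar> \<le> \<epsilon> * L2_set (\<lambda>i. y i - x i) {1..n})"

text \<open>The derivative map is identified with the gradient, so its differentiability is that of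
  all the first partial derivatives.\<close>

definition twice_differentiable_Rn :: "nat \<Rightarrow> ((nat \<Rightarrow> real) \<Rightarrow> real) \<Rightarrow> bool" where
  "twice_differentiable_Rn n \<Phi> \<longleftrightarrow>
     (\<forall>x\<in>Rn n. differentiable_Rn n \<Phi> x \<and> (\<forall>k\<in>{1..n}. differentiable_Rn n (partial k \<Phi>) x))"

definition sup_norm :: "nat \<Rightarrow> ((nat \<Rightarrow> real) \<Rightarrow> real) \<Rightarrow> ereal" where
  "sup_norm n F = (SUP s\<in>Rn n. ereal \<bar>F s\<bar>)"

definition first_order_bound :: "nat \<Rightarrow> ((nat \<Rightarrow> real) \<Rightarrow> real) \<Rightarrow> real \<Rightarrow> bool" where
  "first_order_bound n \<Phi> L \<longleftrightarrow> (\<forall>k\<in>{1..n}. sup_norm n (partial k \<Phi>) \<le> ereal L)"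

text \<open>The finiteness conjunct expresses that the square root of an infinite sum is infinite,
  hence not bounded by the real number \<open>M\<close>; \<open>real_of_ereal\<close> would send
  \<open>\<infinity>\<close> to \<open>0\<close>.\<close>

definition mixed_second_order_bound :: "nat \<Rightarrow> ((nat \<Rightarrow> real) \<Rightarrow> real) \<Rightarrow> real \<Rightarrow> bool" where
  "mixed_second_order_bound n \<Phi> M \<longleftrightarrow>
     (\<forall>k\<in>{1..n}. sup_norm n (\<lambda>s. \<Sum>l\<in>{1..n} - {k}. (partial l (partial k \<Phi>) s)\<^sup>2) < \<infinity>) \<and>
     sqrt (\<Sum>k=1..n. real_of_ereal
        (sup_norm n (\<lambda>s. \<Sum>l\<in>{1..n} - {k}. (partial l (partial k \<Phi>) s)\<^sup>2))) \<le> M"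

definition independent_copy ::
  "'w measure \<Rightarrow> 'x measure \<Rightarrow> nat \<Rightarrow> (nat \<Rightarrow> 'w \<Rightarrow> 'x) \<Rightarrow> (nat \<Rightarrow> 'w \<Rightarrow> 'x) \<Rightarrow> bool" where
  "independent_copy P S n X X' \<longleftrightarrow>
     prob_space.indep_var P
       (PiM {1..n} (\<lambda>_. S)) (\<lambda>\<omega>. \<lambda>i\<in>{1..n}. X i \<omega>)
       (PiM {1..n} (\<lambda>_. S)) (\<lambda>\<omega>. \<lambda>i\<in>{1..n}. X' i \<omega>) \<and>
     distr P (PiM {1..n} (\<lambda>_. S)) (\<lambda>\<omega>. \<lambda>i\<in>{1..n}. X' i \<omega>) =
     distr P (PiM {1..n} (\<lambda>_. S)) (\<lambda>\<omega>. \<lambda>i\<in>{1..n}. X i \<omega>)"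

text \<open>\<open>uniform_bound TYPE('w) TYPE('x) c\<close>: both inequalities hold with the constant \<open>c\<close>, for
  all probability spaces on \<open>'w\<close>, all measurable spaces \<open>S\<close> on \<open>'x\<close>, and all \<open>n\<close>, \<open>X\<close>, \<open>X'\<close>,
  \<open>\<F>\<close>, \<open>\<Phi>\<close>, \<open>L\<close>, \<open>M\<close>, \<open>\<delta>\<close>.

  The constant must not depend on the types either, but HOL has no quantifier over types that
  could stand behind \<open>\<exists>c\<close>, and in \<open>\<exists>c>0. uniform_bound TYPE('w) TYPE('x) c\<close> the witness may
  vary with \<open>'w\<close> and \<open>'x\<close>. The theorem is therefore stated as: a constant exists for one
  closed choice of types, and each constant that works for that choice works for all types.\<close>

definition uniform_bound :: "'w itself \<Rightarrow> 'x itself \<Rightarrow> real \<Rightarrow> bool" where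
  "uniform_bound (W :: 'w itself) (T :: 'x itself) c \<longleftrightarrow>
     (\<forall>(P :: 'w measure) (S :: 'x measure) (n :: nat)
        (X :: nat \<Rightarrow> 'w \<Rightarrow> 'x) (X' :: nat \<Rightarrow> 'w \<Rightarrow> 'x)
        (\<F> :: ('x \<Rightarrow> real) set) (\<Phi> :: (nat \<Rightarrow> real) \<Rightarrow> real) (L :: real) (M :: real).
        prob_space P \<longrightarrow>
        n \<ge> 1 \<longrightarrow>
        prob_space.indep_vars P (\<lambda>_. S) X {1..n} \<longrightarrow>
        independent_copy P S n X X' \<longrightarrow>
        finite \<F> \<longrightarrow> \<F> \<noteq> {} \<longrightarrow>
        (\<forall>f\<in>\<F>. f \<in> borel_measurable S \<and> (\<forall>x\<in>space S. f x \<in> {0..1})) \<longrightarrow>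
        twice_differentiable_Rn n \<Phi> \<longrightarrow>
        first_order_bound n \<Phi> L \<longrightarrow>
        mixed_second_order_bound n \<Phi> M \<longrightarrow>
        (\<integral>\<omega>. (SUP f\<in>\<F>. (\<integral>\<omega>'. \<Phi> (map_vec n f (\<lambda>i. X' i \<omega>')) \<partial>P)
                      - \<Phi> (map_vec n f (\<lambda>i. X i \<omega>))) \<partial>P)
          \<le> c * (M + L) * (\<integral>\<omega>. gaussian_average n (class_image n \<F> (\<lambda>i. X i \<omega>)) \<partial>P) \<and>
        (\<forall>\<delta>>0. measure P {\<omega>\<in>space P. \<forall>f\<in>\<F>.
            (\<integral>\<omega>'. \<Phi> (map_vec n f (\<lambda>i. X' i \<omega>')) \<partial>P)
            \<le> \<Phi> (map_vec n f (\<lambda>i. X i \<omega>))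
              + c * (L + M) * (\<integral>\<omega>'. gaussian_average n (class_image n \<F> (\<lambda>i. X i \<omega>')) \<partial>P)
              + L * sqrt (real n * ln (1 / \<delta>) / 2)} \<ge> 1 - \<delta>))"

end

theory Submission
  imports Defs
begin

text \<open>Write \<open>y\<^sup>A\<close> for the vector that takes the coordinates in \<open>A\<close> from \<open>f(x')\<close> and the others from
  \<open>f(x)\<close>. Exchanging \<open>X\<^sub>k\<close> and \<open>X'\<^sub>k\<close> for the indices in any set does not change the joint law,
  so the expected deviation is at most the expectation over \<open>x\<close>, \<open>x'\<close> of the average over all \<open>A\<close>
  of \<open>sup\<^sub>f (\<Phi>(y\<^sup>A) - \<Phi>(y\<^sup>B))\<close>, where \<open>B\<close> is the complement of \<open>A\<close> (\<open>distr_swap_coordinates\<close>,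
  \<open>expectation_deviation_le\<close>). For fixed \<open>x\<close>, \<open>x'\<close> this is the supremum of a process on the
  discrete cube. It has mean \<open>0\<close>, and the two bounds on the derivatives of \<open>\<Phi>\<close> say that its
  \<open>k\<close>-th discrete derivatives for \<open>f\<close> and \<open>g\<close> differ by at most a Euclidean distance between
  \<open>f(x, x')\<close> and \<open>g(x, x')\<close>, in which coordinate \<open>k\<close> has the additional weight \<open>L\<^sup>2\<close> and all
  coordinates have the weight \<open>\<parallel>\<Sum>\<^bsub>l\<noteq>k\<^esub> (\<partial>\<^sub>l\<^sub>k\<Phi>)\<^sup>2\<parallel>\<^sub>\<infinity>\<close>, up to constants (\<open>mixed_difference_le\<close>).

  The process has subgaussian increments, and generic chaining would compare it with a Gaussian
  one. Here a direct comparison is possible, because the increments are controlled one cube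
  coordinate at a time. If \<open>a f - a g\<close> is at most the expectation of \<open>\<bar>W f - W g\<bar>\<close> for a centred
  Gaussian vector \<open>W\<close>, then a random sign in front of \<open>a\<close> may be replaced by \<open>W\<close>: the average of
  \<open>sup\<^sub>f (z f + a f)\<close> and \<open>sup\<^sub>f (z f - a f)\<close> involves only two maximisers \<open>f\<close>, \<open>g\<close>, and equals
  \<open>(z f + z g + a f - a g) / 2\<close>, while the symmetry of \<open>W\<close> gives \<open>E sup (z + W) \<ge> (z f + z g + E
  \<bar>W f - W g\<bar>) / 2\<close> (\<open>two_point_max_le_gaussian_max\<close>). Doing this for one coordinate of the cube
  after the other replaces the whole process by its mean plus a sum of independent Gaussian
  vectors (\<open>hypercube_average_shifted_gaussian_max\<close>). Their weights add up to the same
  number in every coordinate, at most a multiple of \<open>L\<^sup>2 + M\<^sup>2\<close>, so that the sum is distributed as a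
  multiple of one standard Gaussian vector, and the Gaussian averages of \<open>\<F>(x)\<close> and \<open>\<F>(x')\<close> appear with the factor \<open>L + M\<close>
  (\<open>hypercube_symmetrized_bound\<close>). The constant obtained is \<open>2 sqrt (3 \<pi> / 2)\<close>.

  For the probability bound, changing one coordinate of \<open>x\<close> changes the supremum by at most \<open>L\<close>,
  since the functions in \<open>\<F>\<close> have values in \<open>[0, 1]\<close>; the bounded difference inequality
  (\<open>bounded_differences_tail\<close>) adds the remaining term.

  All quantities depend only on the joint law of the finitely many real variables \<open>f(X\<^sub>i)\<close>,
  \<open>f(X'\<^sub>i)\<close>. Coding them as one sequence of reals realises every instance on the type \<open>nat \<Rightarrow>
  real\<close>, so a constant that works for that type works for all types (\<open>uniform_bound_transfer\<close>).\<close>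

section \<open>Differential calculus on coordinate functions\<close>

text \<open>Testing the derivative along the coordinate axes identifies the representing functional, of
  which the definition asserts only the existence, as the vector of the partial derivatives. In
  particular \<open>deriv\<close> in \<open>partial\<close> is applied to a differentiable function.\<close>

lemma differentiable_RnD:
  assumes "differentiable_Rn n F x" "x \<in> Rn n"
  shows partial_has_derivative:
      "\<And>k. k \<in> {1..n} \<Longrightarrow> ((\<lambda>t. F (x(k := t))) has_real_derivative partial k F x) (at (x k))"
    and has_gradient_partial: 
      "\<And>\<epsilon>. \<epsilon> > 0 \<Longrightarrow> \<exists>d>0. \<forall>y\<in>Rn n. L2_set (\<lambda>i. y i - x i) {1..n} < d \<longrightarrow>
        \<bar>F y - F x - (\<Sum>i=1..n. partial i F x * (y i - x i))\<bar> \<le> \<epsilon> * L2_set (\<lambda>i. y i - x i) {1..n}"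
proof -
  obtain g :: "nat \<Rightarrow> real" where g: "\<And>\<epsilon>. \<epsilon> > 0 \<Longrightarrow> \<exists>d>0. \<forall>y\<in>Rn n.
        L2_set (\<lambda>i. y i - x i) {1..n} < d \<longrightarrow>
        \<bar>F y - F x - (\<Sum>i=1..n. g i * (y i - x i))\<bar> \<le> \<epsilon> * L2_set (\<lambda>i. y i - x i) {1..n}"
    using assms(1) unfolding differentiable_Rn_def by blast
  have D: "((\<lambda>t. F (x(k := t))) has_real_derivative g k) (at (x k))" if k: "k \<in> {1..n}" for k
    unfolding has_field_derivative_def has_derivative_at_alt
  proof (intro conjI allI impI)
    show "bounded_linear ((*) (g k))" by (rule bounded_linear_mult_right)
    fix e :: real assume "e > 0"
    from g[OF this] obtain d where d: "d > 0" "\<And>y. y\<in>Rn n \<Longrightarrow> L2_set (\<lambda>i. y i - x i) {1..n} < d \<Longrightarrow>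
        \<bar>F y - F x - (\<Sum>i=1..n. g i * (y i - x i))\<bar> \<le> e * L2_set (\<lambda>i. y i - x i) {1..n}" by blast
    have "norm (F (x(k := t)) - F (x(k := x k)) - g k * (t - x k)) \<le> e * norm (t - x k)"
      if t: "norm (t - x k) < d" for t
    proof -
      have mem: "x(k := t) \<in> Rn n" using assms(2) k by (auto simp: Rn_def PiE_def extensional_def)
      have "L2_set (\<lambda>i. (x(k:=t)) i - x i) {1..n} = sqrt (\<Sum>i\<in>{1..n}. if i = k then (t - x k)^2 else 0)"
        unfolding L2_set_def by (intro arg_cong[of _ _ sqrt] sum.cong) auto
      also have "\<dots> = \<bar>t - x k\<bar>" using k by (simp add: real_sqrt_abs)
      finally have 1: "L2_set (\<lambda>i. (x(k:=t)) i - x i) {1..n} = \<bar>t - x k\<bar>" .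
      have "(\<Sum>i=1..n. g i * ((x(k:=t)) i - x i)) = (\<Sum>i\<in>{1..n}. if i = k then g k * (t - x k) else 0)"
        by (intro sum.cong) auto
      also have "\<dots> = g k * (t - x k)" using k by simp
      finally have 2: "(\<Sum>i=1..n. g i * ((x(k:=t)) i - x i)) = g k * (t - x k)" .
      show ?thesis using d(2)[OF mem] t unfolding 1 2 by simp
    qed
    with \<open>d > 0\<close> show "\<exists>d>0. \<forall>y. norm (y - x k) < d \<longrightarrow>
        norm (F (x(k := y)) - F (x(k := x k)) - g k * (y - x k)) \<le> e * norm (y - x k)" by blast
  qed
  have P: "partial k F x = g k" if "k \<in> {1..n}" for k
    unfolding partial_def by (rule DERIV_imp_deriv[OF D[OF that]])
  show "((\<lambda>t. F (x(k := t))) has_real_derivative partial k F x) (at (x k))" if "k \<in> {1..n}" for k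
    using D[OF that] P[OF that] by simp
  have S: "(\<Sum>i=1..n. partial i F x * (y i - x i)) = (\<Sum>i=1..n. g i * (y i - x i))" for y :: "nat \<Rightarrow> real"
    by (intro sum.cong refl) (simp add: P)
  show "\<exists>d>0. \<forall>y\<in>Rn n. L2_set (\<lambda>i. y i - x i) {1..n} < d \<longrightarrow>
        \<bar>F y - F x - (\<Sum>i=1..n. partial i F x * (y i - x i))\<bar> \<le> \<epsilon> * L2_set (\<lambda>i. y i - x i) {1..n}"
    if "\<epsilon> > 0" for \<epsilon> using g[OF that] unfolding S .
qed

text \<open>Along the segment from \<open>u\<close> to \<open>v\<close> the function has the gradient applied to \<open>v - u\<close> as its
  derivative, so the mean value theorem on the real line applies.\<close>

lemma mean_value_Rn:
  assumes diff: "\<And>x. x \<in> Rn n \<Longrightarrow> differentiable_Rn n F x"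
    and u: "u \<in> Rn n" and v: "v \<in> Rn n"
  obtains p where "p \<in> Rn n" "F v - F u = (\<Sum>i=1..n. partial i F p * (v i - u i))"
proof -
  define q where "q s = (\<lambda>i\<in>{1..n}. u i + s * (v i - u i))" for s :: real
  have q: "q s \<in> Rn n" for s by (auto simp: q_def Rn_def)
  have q0: "q 0 = u" using u by (auto simp: q_def Rn_def PiE_def extensional_def)
  have q1: "q 1 = v" using v by (auto simp: q_def Rn_def PiE_def extensional_def)
  define N where "N = L2_set (\<lambda>i. v i - u i) {1..n}"
  have N0: "N \<ge> 0" by (simp add: N_def)
  have D: "((\<lambda>s. F (q s)) has_real_derivative (\<Sum>i=1..n. partial i F (q s) * (v i - u i))) (at s)" for s
    unfolding has_field_derivative_def has_derivative_at_alt
  proof (intro conjI allI impI)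
    show "bounded_linear ((*) (\<Sum>i=1..n. partial i F (q s) * (v i - u i)))" by (rule bounded_linear_mult_right)
    fix e :: real assume e: "e > 0"
    have eN: "e / (N + 1) > 0" using e N0 by simp
    obtain d where d: "d > 0" "\<And>y. y\<in>Rn n \<Longrightarrow> L2_set (\<lambda>i. y i - q s i) {1..n} < d \<Longrightarrow>
        \<bar>F y - F (q s) - (\<Sum>i=1..n. partial i F (q s) * (y i - q s i))\<bar>
          \<le> e / (N+1) * L2_set (\<lambda>i. y i - q s i) {1..n}"
      using has_gradient_partial[OF diff[OF q] q eN] by blast
    have "norm (F (q t) - F (q s) - (\<Sum>i=1..n. partial i F (q s) * (v i - u i)) * (t - s)) \<le> e * norm (t - s)"
      if t: "norm (t - s) < d / (N + 1)" for t
    proof -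
      have dq: "q t i - q s i = (t - s) * (v i - u i)" if "i \<in> {1..n}" for i
        using that by (simp add: q_def algebra_simps)
      have "L2_set (\<lambda>i. q t i - q s i) {1..n} = L2_set (\<lambda>i. \<bar>t - s\<bar> * (v i - u i)) {1..n}"
        unfolding L2_set_def by (intro arg_cong[of _ _ sqrt] sum.cong) (auto simp: dq power_mult_distrib)
      also have "\<dots> = \<bar>t - s\<bar> * N" unfolding N_def by (simp add: L2_set_right_distrib)
      finally have 1: "L2_set (\<lambda>i. q t i - q s i) {1..n} = \<bar>t - s\<bar> * N" .
      have 2: "(\<Sum>i=1..n. partial i F (q s) * (q t i - q s i)) = (\<Sum>i=1..n. partial i F (q s) * (v i - u i)) * (t - s)"
        unfolding sum_distrib_right by (intro sum.cong) (auto simp: dq)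
      have "\<bar>t - s\<bar> * (N + 1) < d" using t N0 by (simp add: field_simps)
      then have "\<bar>t - s\<bar> * N < d" by (smt (verit) distrib_left mult_cancel_left2 abs_ge_zero)
      from d(2)[OF q, of t, unfolded 1 2, OF this]
      have "\<bar>F (q t) - F (q s) - (\<Sum>i=1..n. partial i F (q s) * (v i - u i)) * (t - s)\<bar> \<le> e * \<bar>t - s\<bar> * (N / (N+1))"
        by (simp add: field_simps)
      also have "\<dots> \<le> e * \<bar>t - s\<bar> * 1" using e N0 by (intro mult_left_mono) auto
      finally show ?thesis by simp
    qed
    then show "\<exists>d>0. \<forall>y. norm (y - s) < d \<longrightarrow>
        norm (F (q y) - F (q s) - (\<Sum>i=1..n. partial i F (q s) * (v i - u i)) * (y - s)) \<le> e * norm (y - s)"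
      using d(1) N0 by (intro exI[of _ "d/(N+1)"]) auto
  qed
  from MVT2[of 0 1 "\<lambda>s. F (q s)", OF _ D] obtain z
    where "F (q 1) - F (q 0) = (1 - 0) * (\<Sum>i=1..n. partial i F (q z) * (v i - u i))" by auto
  then show thesis using that[OF q[of z]] unfolding q0 q1 by simp
qed

lemma sup_norm_ge: "s \<in> Rn n \<Longrightarrow> ereal \<bar>F s\<bar> \<le> sup_norm n F"
  unfolding sup_norm_def by (rule SUP_upper)

lemma Rn_not_empty: "(\<lambda>i\<in>{1..n}. 0) \<in> Rn n"
  by (auto simp: Rn_def)

lemma sup_norm_nonneg: "0 \<le> sup_norm n F"
  using sup_norm_ge[OF Rn_not_empty, of F] by (rule order_trans[rotated]) simp

lemma first_order_boundD:
  assumes "first_order_bound n \<Phi> L" "k \<in> {1..n}" "x \<in> Rn n"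
  shows "\<bar>partial k \<Phi> x\<bar> \<le> L"
proof -
  have "ereal \<bar>partial k \<Phi> x\<bar> \<le> ereal L"
    using sup_norm_ge[OF assms(3), of "partial k \<Phi>"] assms(1,2) unfolding first_order_bound_def
    by (meson order_trans)
  then show ?thesis by simp
qed

lemma first_order_bound_nonneg:
  assumes "first_order_bound n \<Phi> L" "n \<ge> 1"
  shows "0 \<le> L"
  using first_order_boundD[OF assms(1) _ Rn_not_empty, of 1] assms(2) by force

lemma Lipschitz_Rn:
  assumes "twice_differentiable_Rn n \<Phi>" "first_order_bound n \<Phi> L" "u \<in> Rn n" "v \<in> Rn n"
  shows "\<bar>\<Phi> v - \<Phi> u\<bar> \<le> L * (\<Sum>i=1..n. \<bar>v i - u i\<bar>)"
proof -
  have "differentiable_Rn n \<Phi> x" if "x \<in> Rn n" for x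
    using assms(1) that by (auto simp: twice_differentiable_Rn_def)
  from mean_value_Rn[OF this assms(3,4)]
  obtain p where p: "p \<in> Rn n" "\<Phi> v - \<Phi> u = (\<Sum>i=1..n. partial i \<Phi> p * (v i - u i))" by metis
  have "\<bar>\<Phi> v - \<Phi> u\<bar> \<le> (\<Sum>i=1..n. \<bar>partial i \<Phi> p * (v i - u i)\<bar>)" unfolding p(2) by (rule sum_abs)
  also have "\<dots> \<le> (\<Sum>i=1..n. L * \<bar>v i - u i\<bar>)"
    unfolding abs_mult by (intro sum_mono mult_right_mono first_order_boundD[OF assms(2) _ p(1)]) auto
  finally show ?thesis by (simp add: sum_distrib_left)
qed

text \<open>The square of the strength with which the other coordinates act on the \<open>k\<close>-th partial
  derivative; squares are the quantities that add up over \<open>k\<close>.\<close>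

definition interaction :: "nat \<Rightarrow> ((nat \<Rightarrow> real) \<Rightarrow> real) \<Rightarrow> nat \<Rightarrow> real" where
  "interaction n \<Phi> k = real_of_ereal (sup_norm n (\<lambda>s. \<Sum>l\<in>{1..n} - {k}. (partial l (partial k \<Phi>) s)\<^sup>2))"

lemma interaction_nonneg: "0 \<le> interaction n \<Phi> k"
  unfolding interaction_def by (rule real_of_ereal_pos[OF sup_norm_nonneg])

lemma mixed_second_order_boundD:
  assumes "mixed_second_order_bound n \<Phi> M"
  shows mixed_second_order_bound_nonneg: "0 \<le> M" 
    and sum_interaction_le: "(\<Sum>k=1..n. interaction n \<Phi> k) \<le> M\<^sup>2"
    and interaction_ge: "\<And>k s. k \<in> {1..n} \<Longrightarrow> s \<in> Rn n \<Longrightarrow>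
      (\<Sum>l\<in>{1..n} - {k}. (partial l (partial k \<Phi>) s)\<^sup>2) \<le> interaction n \<Phi> k"
proof -
  have sq: "sqrt (\<Sum>k=1..n. interaction n \<Phi> k) \<le> M"
    using assms unfolding mixed_second_order_bound_def interaction_def by simp
  have s0: "0 \<le> (\<Sum>k=1..n. interaction n \<Phi> k)" by (intro sum_nonneg interaction_nonneg)
  show "0 \<le> M" using sq s0 by (smt (verit) real_sqrt_ge_zero)
  show "(\<Sum>k=1..n. interaction n \<Phi> k) \<le> M\<^sup>2"
    using sq s0 sqrt_le_D by blast
  fix k s assume k: "k \<in> {1..n}" and s: "s \<in> Rn n"
  let ?F = "\<lambda>s. \<Sum>l\<in>{1..n} - {k}. (partial l (partial k \<Phi>) s)\<^sup>2"
  have fin: "sup_norm n ?F < \<infinity>"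
    using assms k unfolding mixed_second_order_bound_def by blast
  have "ereal (interaction n \<Phi> k) = sup_norm n ?F"
    unfolding interaction_def using fin sup_norm_nonneg[of n ?F] by (auto simp: ereal_real)
  then have "ereal \<bar>?F s\<bar> \<le> ereal (interaction n \<Phi> k)"
    using sup_norm_ge[OF s, of ?F] by simp
  then show "?F s \<le> interaction n \<Phi> k" by simp
qed

lemma fun_upd_Rn: "u \<in> Rn n \<Longrightarrow> k \<in> {1..n} \<Longrightarrow> u(k := a) \<in> Rn n"
  by (auto simp: Rn_def PiE_def extensional_def)

text \<open>Cauchy--Schwarz in the mean value theorem. The term with \<open>\<partial>\<^sub>k\<^sub>k\<Phi>\<close> drops out because \<open>u\<close> and \<open>v\<close>
  agree in coordinate \<open>k\<close>; this is why only mixed second derivatives have to be bounded.\<close>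

lemma partial_difference_le:
  assumes td: "twice_differentiable_Rn n \<Phi>" and M: "mixed_second_order_bound n \<Phi> M"
    and k: "k \<in> {1..n}" and u: "u \<in> Rn n" and v: "v \<in> Rn n" and eq: "u k = v k"
  shows "\<bar>partial k \<Phi> v - partial k \<Phi> u\<bar> \<le> sqrt (interaction n \<Phi> k) * L2_set (\<lambda>l. v l - u l) ({1..n} - {k})"
proof -
  have "differentiable_Rn n (partial k \<Phi>) x" if "x \<in> Rn n" for x
    using td k that by (auto simp: twice_differentiable_Rn_def)
  from mean_value_Rn[OF this u v]
  obtain p where p: "p \<in> Rn n"
    "partial k \<Phi> v - partial k \<Phi> u = (\<Sum>i=1..n. partial i (partial k \<Phi>) p * (v i - u i))" by metis
  note p(2)
  also have "(\<Sum>i=1..n. partial i (partial k \<Phi>) p * (v i - u i))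
     = (\<Sum>i\<in>{1..n}-{k}. partial i (partial k \<Phi>) p * (v i - u i))"
    using eq k by (subst sum.remove[of _ k]) auto
  finally have "\<bar>partial k \<Phi> v - partial k \<Phi> u\<bar> \<le>
      (\<Sum>i\<in>{1..n}-{k}. \<bar>partial i (partial k \<Phi>) p\<bar> * \<bar>v i - u i\<bar>)"
    by (simp flip: abs_mult)
  also have "\<dots> \<le> L2_set (\<lambda>i. partial i (partial k \<Phi>) p) ({1..n}-{k}) * L2_set (\<lambda>i. v i - u i) ({1..n}-{k})"
    by (rule L2_set_mult_ineq)
  also have "\<dots> \<le> sqrt (interaction n \<Phi> k) * L2_set (\<lambda>i. v i - u i) ({1..n}-{k})"
    unfolding L2_set_def
    by (intro mult_right_mono real_sqrt_le_mono interaction_ge[OF M k p(1)] real_sqrt_ge_zero sum_nonneg) auto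
  finally show ?thesis .
qed

text \<open>Compares the increments of \<open>\<Phi>\<close> in coordinate \<open>k\<close> at two base points. Moving the end points
  \<open>a'\<close>, \<open>a\<close> at \<open>u\<close> to the end points \<open>b'\<close>, \<open>b\<close> used at \<open>v\<close> costs the two terms with \<open>L\<close>. After
  that both increments are over the same interval, of length at most \<open>1\<close>, and their difference is
  controlled by the derivative of \<open>s \<mapsto> \<Phi> (u(k := s)) - \<Phi> (v(k := s))\<close>.\<close>

lemma mixed_difference_le:
  assumes td: "twice_differentiable_Rn n \<Phi>" and L: "first_order_bound n \<Phi> L"
    and M: "mixed_second_order_bound n \<Phi> M"
    and k: "k \<in> {1..n}" and u: "u \<in> Rn n" and v: "v \<in> Rn n"
    and b: "0 \<le> b" "b \<le> 1" "0 \<le> b'" "b' \<le> 1"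
  shows "\<bar>(\<Phi> (u(k := a')) - \<Phi> (u(k := a))) - (\<Phi> (v(k := b')) - \<Phi> (v(k := b)))\<bar>
     \<le> L * \<bar>a' - b'\<bar> + L * \<bar>a - b\<bar> + sqrt (interaction n \<Phi> k) * L2_set (\<lambda>l. u l - v l) ({1..n} - {k})"
proof -
  let ?S = "sqrt (interaction n \<Phi> k) * L2_set (\<lambda>l. u l - v l) ({1..n} - {k})"
  have S0: "?S \<ge> 0" by (simp add: interaction_nonneg)
  have one: "\<bar>\<Phi> (u(k := s)) - \<Phi> (u(k := t))\<bar> \<le> L * \<bar>s - t\<bar>" for s t
  proof -
    have "\<bar>\<Phi> (u(k := s)) - \<Phi> (u(k := t))\<bar> \<le> L * (\<Sum>i=1..n. \<bar>(u(k := s)) i - (u(k:=t)) i\<bar>)"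
      by (rule Lipschitz_Rn[OF td L]) (use u k in \<open>auto intro: fun_upd_Rn\<close>)
    also have "(\<Sum>i=1..n. \<bar>(u(k := s)) i - (u(k:=t)) i\<bar>) = (\<Sum>i=1..n. if i = k then \<bar>s - t\<bar> else 0)"
      by (intro sum.cong) auto
    also have "\<dots> = \<bar>s - t\<bar>" using k by simp
    finally show ?thesis .
  qed
  define \<theta> where "\<theta> s = \<Phi> (u(k := s)) - \<Phi> (v(k := s))" for s
  have D1: "((\<lambda>s. \<Phi> (w(k := s))) has_real_derivative partial k \<Phi> (w(k := s))) (at s)" if "w \<in> Rn n" for w s
  proof -
    have "w(k := s) \<in> Rn n" by (rule fun_upd_Rn[OF that k])
    moreover from this td have "differentiable_Rn n \<Phi> (w(k := s))" by (auto simp: twice_differentiable_Rn_def)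
    ultimately show ?thesis using partial_has_derivative[of n \<Phi> "w(k := s)" k] k by simp
  qed
  have D: "(\<theta> has_real_derivative (partial k \<Phi> (u(k := s)) - partial k \<Phi> (v(k := s)))) (at s)" for s
    unfolding \<theta>_def by (intro DERIV_diff D1 u v)
  have bd: "\<bar>partial k \<Phi> (u(k := s)) - partial k \<Phi> (v(k := s))\<bar> \<le> ?S" for s
  proof -
    have "\<bar>partial k \<Phi> (u(k := s)) - partial k \<Phi> (v(k := s))\<bar>
        \<le> sqrt (interaction n \<Phi> k) * L2_set (\<lambda>l. (u(k := s)) l - (v(k := s)) l) ({1..n} - {k})"
      by (rule partial_difference_le[OF td M k]) (use u v k in \<open>auto intro: fun_upd_Rn\<close>)
    also have "L2_set (\<lambda>l. (u(k := s)) l - (v(k := s)) l) ({1..n} - {k}) = L2_set (\<lambda>l. u l - v l) ({1..n} - {k})"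
      unfolding L2_set_def by (intro arg_cong[of _ _ sqrt] sum.cong) auto
    finally show ?thesis .
  qed
  have "norm (\<theta> b' - \<theta> b) \<le> ?S * norm (b' - b)"
    by (rule field_differentiable_bound[of UNIV \<theta> "\<lambda>s. partial k \<Phi> (u(k := s)) - partial k \<Phi> (v(k := s))" ?S b' b])
       (use D bd in \<open>auto\<close>)
  also have "\<dots> \<le> ?S * 1" using S0 b by (intro mult_left_mono) auto
  finally have "\<bar>\<theta> b' - \<theta> b\<bar> \<le> ?S" by simp
  with one[of a' b'] one[of a b] show ?thesis unfolding \<theta>_def by argo
qed

section \<open>Finite suprema and product measures\<close>

lemma integrable_SUP_finite:
  fixes h :: "'f \<Rightarrow> 'a \<Rightarrow> real"
  assumes F: "finite F" "F \<noteq> {}" and h: "\<And>f. f \<in> F \<Longrightarrow> integrable M (h f)"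
  shows "integrable M (\<lambda>x. SUP f\<in>F. h f x)"
proof (rule Bochner_Integration.integrable_bound)
  show "integrable M (\<lambda>x. \<Sum>f\<in>F. \<bar>h f x\<bar>)" using h by (auto intro!: integrable_sum integrable_abs)
  show "(\<lambda>x. SUP f\<in>F. h f x) \<in> borel_measurable M"
    by (rule borel_measurable_cSUP) (use F h in \<open>auto intro: countable_finite\<close>)
  show "AE x in M. norm (SUP f\<in>F. h f x) \<le> norm (\<Sum>f\<in>F. \<bar>h f x\<bar>)"
  proof (intro AE_I2)
    fix x
    have "(SUP f\<in>F. h f x) \<in> (\<lambda>f. h f x) ` F"
      using F by (subst cSup_eq_Max) auto
    then obtain f where f: "f \<in> F" "(SUP f\<in>F. h f x) = h f x" by auto
    have "\<bar>h f x\<bar> \<le> (\<Sum>f\<in>F. \<bar>h f x\<bar>)" using F f(1) by (intro member_le_sum) auto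
    then show "norm (SUP f\<in>F. h f x) \<le> norm (\<Sum>f\<in>F. \<bar>h f x\<bar>)" unfolding f(2) by simp
  qed
qed

lemma SUP_finite_attained:
  fixes h :: "'f \<Rightarrow> real"
  assumes F: "finite F" "F \<noteq> {}"
  obtains f where "f \<in> F" "(SUP f\<in>F. h f) = h f"
proof -
  have "(SUP f\<in>F. h f) \<in> h ` F" using F by (subst cSup_eq_Max) auto
  then show thesis using that by auto
qed

lemma SUP_finite_upper:
  fixes h :: "'f \<Rightarrow> real"
  shows "finite F \<Longrightarrow> f \<in> F \<Longrightarrow> h f \<le> (SUP f\<in>F. h f)"
  by (intro cSUP_upper bdd_above_finite) auto

lemma (in pair_prob_space) distr_pair_snd: "distr (M1 \<Otimes>\<^sub>M M2) M2 snd = M2"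
proof -
  have "distr (M1 \<Otimes>\<^sub>M M2) M2 snd = distr (distr (M2 \<Otimes>\<^sub>M M1) (M1 \<Otimes>\<^sub>M M2) (\<lambda>(x, y). (y, x))) M2 snd"
    by (rule arg_cong[where f = "\<lambda>N. distr N M2 snd", OF distr_pair_swap])
  also have "\<dots> = distr (M2 \<Otimes>\<^sub>M M1) M2 fst"
    by (subst distr_distr) (auto simp: comp_def case_prod_beta')
  also have "\<dots> = M2" by (rule M1.distr_pair_fst)
  finally show ?thesis .
qed

text \<open>If two independent vectors have independent coordinates, then any coordinatewise function of
  the two has independent coordinates. On a box this is Fubini's theorem, as the sections of the
  preimage of a box are boxes. With \<open>\<phi> i\<close> an exchange of the two components this yields the
  symmetrization, with \<open>\<phi> i\<close> a linear combination the stability of Gaussian vectors under sums.\<close>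

lemma distr_zip_PiM:
  fixes \<phi> :: "'i \<Rightarrow> 'a \<times> 'b \<Rightarrow> 'c"
  assumes I: "finite I"
    and A: "\<And>i. i \<in> I \<Longrightarrow> prob_space (A i)" and B: "\<And>i. i \<in> I \<Longrightarrow> prob_space (B i)"
    and \<phi>: "\<And>i. i \<in> I \<Longrightarrow> \<phi> i \<in> measurable (A i \<Otimes>\<^sub>M B i) (C i)"
  shows "distr (PiM I A \<Otimes>\<^sub>M PiM I B) (PiM I C) (\<lambda>(x, y). \<lambda>i\<in>I. \<phi> i (x i, y i))
    = PiM I (\<lambda>i. distr (A i \<Otimes>\<^sub>M B i) (C i) (\<phi> i))"
proof -
  \<comment> \<open>Factors outside \<open>I\<close> do not affect the products; any probability measure may be put there.\<close>
  define A' where "A' i = (if i \<in> I then A i else return (count_space UNIV) undefined)" for i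
  define B' where "B' i = (if i \<in> I then B i else return (count_space UNIV) undefined)" for i
  define D where "D i = (if i \<in> I then distr (A i \<Otimes>\<^sub>M B i) (C i) (\<phi> i)
    else return (count_space UNIV) undefined)" for i
  have eqs: "PiM I A = PiM I A'" "PiM I B = PiM I B'"
    "PiM I (\<lambda>i. distr (A i \<Otimes>\<^sub>M B i) (C i) (\<phi> i)) = PiM I D"
    by (auto intro!: PiM_cong simp: A'_def B'_def D_def)
  have pA: "prob_space (A' i)" and pB: "prob_space (B' i)" for i
    using A B by (auto simp: A'_def B'_def intro!: prob_space_return)
  have pAB: "prob_space (A i \<Otimes>\<^sub>M B i)" if "i \<in> I" for i
  proof -
    interpret a: prob_space "A i" by (rule A[OF that])
    interpret b: prob_space "B i" by (rule B[OF that])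
    interpret pair_prob_space "A i" "B i" ..
    show ?thesis by (rule prob_space_axioms)
  qed
  have pD: "prob_space (D i)" for i
    using prob_space.prob_space_distr[OF pAB \<phi>] by (auto simp: D_def intro!: prob_space_return)
  interpret A: product_prob_space A' I by (intro product_prob_spaceI pA)
  interpret B: product_prob_space B' I by (intro product_prob_spaceI pB)
  interpret D: product_prob_space D I by (intro product_prob_spaceI pD)
  have pPB: "prob_space (PiM I B')" by (intro prob_space_PiM pB)
  have comp: "(\<lambda>(x, y). \<phi> i (x i, y i)) \<in> measurable (PiM I A' \<Otimes>\<^sub>M PiM I B') (C i)" if i: "i \<in> I" for i
  proof -
    have [measurable]: "\<phi> i \<in> measurable (A' i \<Otimes>\<^sub>M B' i) (C i)"
      using \<phi>[OF i] i by (simp add: A'_def B'_def)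
    show ?thesis using i by measurable
  qed
  have meas: "(\<lambda>(x, y). \<lambda>i\<in>I. \<phi> i (x i, y i)) \<in> measurable (PiM I A' \<Otimes>\<^sub>M PiM I B') (PiM I C)"
    using comp by (auto simp: case_prod_beta' intro!: measurable_restrict)
  show ?thesis unfolding eqs
  proof (rule D.PiM_eqI[OF I])
    show "sets (distr (PiM I A' \<Otimes>\<^sub>M PiM I B') (PiM I C) (\<lambda>(x, y). \<lambda>i\<in>I. \<phi> i (x i, y i))) = sets (PiM I D)"
      by (simp add: D_def cong: sets_PiM_cong)
    fix E assume E: "\<And>i. i \<in> I \<Longrightarrow> E i \<in> sets (D i)"
    then have E': "E i \<in> sets (C i)" if "i \<in> I" for i using E[OF that] that by (simp add: D_def)
    define R where "R i = \<phi> i -` E i \<inter> space (A i \<Otimes>\<^sub>M B i)" for i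
    have R: "R i \<in> sets (A' i \<Otimes>\<^sub>M B' i)" if "i \<in> I" for i
      using measurable_sets[OF \<phi>[OF that] E'[OF that]] that by (simp add: R_def A'_def B'_def)
    let ?V = "(\<lambda>(x, y). \<lambda>i\<in>I. \<phi> i (x i, y i)) -` PiE I E \<inter> space (PiM I A' \<Otimes>\<^sub>M PiM I B')"
    have V: "?V \<in> sets (PiM I A' \<Otimes>\<^sub>M PiM I B')"
      by (rule measurable_sets[OF meas]) (intro sets_PiM_I_finite I E')
    have slice: "emeasure (PiM I B') (Pair x -` ?V) = (\<Prod>i\<in>I. emeasure (B' i) (Pair (x i) -` R i))"
      if x: "x \<in> space (PiM I A')" for x
    proof -
      have "Pair x -` ?V = PiE I (\<lambda>i. Pair (x i) -` R i)"
        using x by (auto simp: space_pair_measure space_PiM R_def PiE_iff A'_def B'_def extensional_def split: if_splits)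
      then show ?thesis
        using R by (simp add: B.emeasure_PiM[OF I] sets_Pair1)
    qed
    have "emeasure (distr (PiM I A' \<Otimes>\<^sub>M PiM I B') (PiM I C) (\<lambda>(x, y). \<lambda>i\<in>I. \<phi> i (x i, y i))) (PiE I E)
       = emeasure (PiM I A' \<Otimes>\<^sub>M PiM I B') ?V"
      by (rule emeasure_distr[OF meas]) (intro sets_PiM_I_finite I E')
    also have "\<dots> = (\<integral>\<^sup>+x. emeasure (PiM I B') (Pair x -` ?V) \<partial>PiM I A')"
      by (rule sigma_finite_measure.emeasure_pair_measure_alt[OF prob_space_imp_sigma_finite[OF pPB] V])
    also have "\<dots> = (\<integral>\<^sup>+x. (\<Prod>i\<in>I. emeasure (B' i) (Pair (x i) -` R i)) \<partial>PiM I A')"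
      by (intro nn_integral_cong slice)
    also have "\<dots> = (\<Prod>i\<in>I. \<integral>\<^sup>+x. emeasure (B' i) (Pair x -` R i) \<partial>A' i)"
      by (rule A.product_nn_integral_prod[OF I]) (auto intro!: B.M.measurable_emeasure_Pair R)
    also have "\<dots> = (\<Prod>i\<in>I. emeasure (A' i \<Otimes>\<^sub>M B' i) (R i))"
      by (intro prod.cong refl B.M.emeasure_pair_measure_alt[symmetric] R)
    also have "\<dots> = (\<Prod>i\<in>I. emeasure (D i) (E i))"
      using \<phi> E' by (intro prod.cong refl) (simp add: D_def A'_def B'_def R_def emeasure_distr)
    finally show "emeasure (distr (PiM I A' \<Otimes>\<^sub>M PiM I B') (PiM I C) (\<lambda>(x, y). \<lambda>i\<in>I. \<phi> i (x i, y i))) (PiE I E)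
      = (\<Prod>i\<in>I. emeasure (D i) (E i))" .
  qed
qed

section \<open>Gaussian vectors\<close>

abbreviation std_normal :: "real measure" where
  "std_normal \<equiv> density lborel (\<lambda>t. ennreal (std_normal_density t))"

abbreviation std_gaussian :: "'i set \<Rightarrow> ('i \<Rightarrow> real) measure" where
  "std_gaussian I \<equiv> PiM I (\<lambda>_. std_normal)"

lemma prob_space_std_normal: "prob_space std_normal"
  using prob_space_normal_density[of 1 0] by simp

lemma prob_space_std_gaussian: "prob_space (std_gaussian I)"
  by (intro prob_space_PiM prob_space_std_normal)

lemma distributed_scaled_std_normal:
  assumes "prob_space M" "X \<in> borel_measurable M" "distr M lborel X = std_normal" "s \<noteq> 0"
  shows "distributed M lborel (\<lambda>x. s * X x) (normal_density 0 \<bar>s\<bar>)"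
proof -
  interpret prob_space M by fact
  have "distributed M lborel X (normal_density 0 1)"
    using assms(2,3) unfolding distributed_def by simp
  from normal_density_affine[OF this _ assms(4), of 0] show ?thesis by simp
qed

lemma distr_scaled_std_normal:
  assumes "s \<noteq> 0"
  shows "distr std_normal lborel (\<lambda>x. s * x) = density lborel (\<lambda>x. ennreal (normal_density 0 \<bar>s\<bar> x))"
proof -
  have "distr std_normal lborel (\<lambda>x. x) = std_normal" by (intro distr_id2) simp
  from distributed_scaled_std_normal[OF prob_space_std_normal _ this assms]
  show ?thesis by (intro distributed_distr_eq_density) simp
qed

text \<open>The cases \<open>s = 0\<close> and \<open>t = 0\<close> are separate because a degenerate normal law has no density.\<close>

lemma distr_add_std_normal:
  assumes s: "s \<ge> 0" and t: "t \<ge> 0"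
  shows "distr (std_normal \<Otimes>\<^sub>M std_normal) borel (\<lambda>(x, y). s * x + t * y)
       = distr std_normal borel (\<lambda>x. sqrt (s\<^sup>2 + t\<^sup>2) * x)"
proof -
  interpret N: prob_space std_normal by (rule prob_space_std_normal)
  interpret NN: pair_prob_space std_normal std_normal ..
  have f: "distr (std_normal \<Otimes>\<^sub>M std_normal) std_normal fst = std_normal"
    by (rule N.distr_pair_fst)
  have g: "distr (std_normal \<Otimes>\<^sub>M std_normal) std_normal snd = std_normal"
    by (rule NN.distr_pair_snd)
  consider "s = 0" | "t = 0" | "s > 0" "t > 0" using s t by linarith
  then show ?thesis
  proof cases
    case 1
    have "distr std_normal borel (\<lambda>x. t * x) = distr (distr (std_normal \<Otimes>\<^sub>M std_normal) std_normal snd) borel (\<lambda>x. t * x)"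
      unfolding g ..
    also have "\<dots> = distr (std_normal \<Otimes>\<^sub>M std_normal) borel (\<lambda>(x, y). t * y)"
      by (subst distr_distr) (auto simp: comp_def case_prod_beta')
    finally show ?thesis using 1 t by simp
  next
    case 2
    have "distr std_normal borel (\<lambda>x. s * x) = distr (distr (std_normal \<Otimes>\<^sub>M std_normal) std_normal fst) borel (\<lambda>x. s * x)"
      unfolding f ..
    also have "\<dots> = distr (std_normal \<Otimes>\<^sub>M std_normal) borel (\<lambda>(x, y). s * x)"
      by (subst distr_distr) (auto simp: comp_def case_prod_beta')
    finally show ?thesis using 2 s by simp
  next
    case 3
    have dl: "distr M borel h = distr M lborel h" for M :: "'z measure" and h :: "'z \<Rightarrow> real"
      by (intro distr_cong) auto
    have dn: "distr M std_normal h = distr M lborel h" for M :: "'z measure" and h :: "'z \<Rightarrow> real"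
      by (intro distr_cong) auto
    have ind: "NN.indep_var borel fst borel snd"
      unfolding NN.indep_var_distribution_eq
    proof (intro conjI)
      show "distr (std_normal \<Otimes>\<^sub>M std_normal) borel fst \<Otimes>\<^sub>M distr (std_normal \<Otimes>\<^sub>M std_normal) borel snd
         = distr (std_normal \<Otimes>\<^sub>M std_normal) (borel \<Otimes>\<^sub>M borel) (\<lambda>x. (fst x, snd x))"
      proof -
        have "sets (std_normal \<Otimes>\<^sub>M std_normal) = sets (borel \<Otimes>\<^sub>M borel)"
          by (intro sets_pair_measure_cong) auto
        then have "distr (std_normal \<Otimes>\<^sub>M std_normal) (borel \<Otimes>\<^sub>M borel) (\<lambda>x. (fst x, snd x)) = std_normal \<Otimes>\<^sub>M std_normal"
          by (subst prod.collapse) (rule distr_id2[OF sym])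
        moreover have "distr (std_normal \<Otimes>\<^sub>M std_normal) borel fst = std_normal"
          "distr (std_normal \<Otimes>\<^sub>M std_normal) borel snd = std_normal"
          using f g unfolding dn dl by auto
        ultimately show ?thesis by simp
      qed
    qed auto
    have ind': "NN.indep_var borel (\<lambda>x. s * fst x) borel (\<lambda>x. t * snd x)"
      using NN.indep_var_compose[OF ind, of "\<lambda>x. s * x" borel "\<lambda>x. t * x" borel] by (simp add: comp_def)
    have X: "distributed (std_normal \<Otimes>\<^sub>M std_normal) lborel (\<lambda>x. s * fst x) (normal_density 0 s)"
      using distributed_scaled_std_normal[OF NN.prob_space_axioms _ f[unfolded dn], of s] 3 by auto
    have Y: "distributed (std_normal \<Otimes>\<^sub>M std_normal) lborel (\<lambda>x. t * snd x) (normal_density 0 t)"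
      using distributed_scaled_std_normal[OF NN.prob_space_axioms _ g[unfolded dn], of t] 3 by auto
    from NN.add_indep_normal[OF ind' 3 X Y]
    have "distr (std_normal \<Otimes>\<^sub>M std_normal) lborel (\<lambda>x. s * fst x + t * snd x)
       = density lborel (normal_density 0 (sqrt (s\<^sup>2 + t\<^sup>2)))"
      by (auto dest: distributed_distr_eq_density)
    also have "\<dots> = distr std_normal lborel (\<lambda>x. sqrt (s\<^sup>2 + t\<^sup>2) * x)"
      using 3 by (subst distr_scaled_std_normal) (auto simp: sum_power2_eq_zero_iff)
    finally show ?thesis unfolding dl by (simp add: case_prod_beta')
  qed
qed

lemma integrable_std_gaussian_component:
  assumes "i \<in> I"
  shows "integrable (std_gaussian I) (\<lambda>\<gamma>. \<gamma> i)"
proof -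
  have "integrable std_normal (\<lambda>x. x)"
    using integrable_std_normal_moment[of 1] by (subst integrable_density) (auto simp: normal_density_nonneg)
  then have "integrable (distr (std_gaussian I) std_normal (\<lambda>\<gamma>. \<gamma> i)) (\<lambda>x. x)"
    using distr_PiM_component[of I "\<lambda>_. std_normal" i] assms prob_space_std_normal by simp
  then show ?thesis using assms by (subst (asm) integrable_distr_eq) auto
qed

lemma integrable_std_gaussian_linear:
  assumes "finite I"
  shows "integrable (std_gaussian I) (\<lambda>\<gamma>. \<Sum>i\<in>I. \<gamma> i * v i)"
  by (intro Bochner_Integration.integrable_sum integrable_mult_left integrable_std_gaussian_component)

lemma integrable_gaussian_max:
  assumes "finite I" "finite F" "F \<noteq> {}"
  shows "integrable (std_gaussian I) (\<lambda>\<gamma>. SUP f\<in>F. z f + (\<Sum>i\<in>I. \<gamma> i * w f i))"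
proof -
  interpret prob_space "std_gaussian I" by (rule prob_space_std_gaussian)
  show ?thesis
    by (intro integrable_SUP_finite assms Bochner_Integration.integrable_add
        integrable_std_gaussian_linear integrable_const)
qed

lemma distributed_std_gaussian_linear:
  assumes I: "finite I" and v: "i0 \<in> I" "v i0 \<noteq> 0"
  shows "distributed (std_gaussian I) lborel (\<lambda>\<gamma>. \<Sum>i\<in>I. \<gamma> i * v i) (normal_density 0 (L2_set v I))"
proof -
  interpret prob_space "std_gaussian I" by (rule prob_space_std_gaussian)
  \<comment> \<open>The terms with \<open>v i = 0\<close> are constant, have no density and must be removed before normal laws are convolved.\<close>
  define J where "J = {i\<in>I. v i \<noteq> 0}"
  have comp: "distr (std_gaussian I) std_normal (\<lambda>\<gamma>. \<gamma> i) = std_normal" if "i \<in> I" for i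
    using distr_PiM_component[of I "\<lambda>_. std_normal" i] that prob_space_std_normal by simp
  have "indep_vars (\<lambda>_. std_normal) (\<lambda>i \<gamma>. \<gamma> i) I"
  proof (subst indep_vars_iff_distr_eq_PiM')
    have "distr (std_gaussian I) (std_gaussian I) (\<lambda>\<gamma>. \<lambda>i\<in>I. \<gamma> i) = distr (std_gaussian I) (std_gaussian I) (\<lambda>\<gamma>. \<gamma>)"
      by (intro distr_cong) (auto simp: space_PiM)
    then show "distr (std_gaussian I) (std_gaussian I) (\<lambda>\<gamma>. \<lambda>i\<in>I. \<gamma> i)
       = PiM I (\<lambda>i. distr (std_gaussian I) std_normal (\<lambda>\<gamma>. \<gamma> i))"
      using comp by (simp cong: PiM_cong)
  qed (use v in auto)
  then have ind: "indep_vars (\<lambda>_. borel) (\<lambda>i \<gamma>. v i * \<gamma> i) J"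
    unfolding J_def by (rule indep_vars_compose2[OF indep_vars_subset]) auto
  have "distributed (std_gaussian I) lborel (\<lambda>\<gamma>. \<Sum>i\<in>J. v i * \<gamma> i) (normal_density (\<Sum>i\<in>J. 0) (sqrt (\<Sum>i\<in>J. \<bar>v i\<bar>\<^sup>2)))"
  proof (rule sum_indep_normal[OF _ _ ind])
    fix i assume i: "i \<in> J"
    show "0 < \<bar>v i\<bar>" using i by (auto simp: J_def)
    have "distr (std_gaussian I) lborel (\<lambda>\<gamma>. \<gamma> i) = distr (std_gaussian I) std_normal (\<lambda>\<gamma>. \<gamma> i)"
      by (intro distr_cong) auto
    then have "distr (std_gaussian I) lborel (\<lambda>\<gamma>. \<gamma> i) = std_normal"
      using comp i by (auto simp: J_def)
    then show "distributed (std_gaussian I) lborel (\<lambda>\<gamma>. v i * \<gamma> i) (normal_density 0 \<bar>v i\<bar>)"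
      using i by (intro distributed_scaled_std_normal prob_space_axioms) (auto simp: J_def)
  qed (use I v in \<open>auto simp: J_def\<close>)
  moreover have "(\<Sum>i\<in>J. v i * \<gamma> i) = (\<Sum>i\<in>I. \<gamma> i * v i)" for \<gamma>
    unfolding J_def using I by (intro sum.mono_neutral_cong_left) auto
  moreover have "(\<Sum>i\<in>J. \<bar>v i\<bar>\<^sup>2) = (\<Sum>i\<in>I. (v i)\<^sup>2)"
    unfolding J_def using I by (intro sum.mono_neutral_cong_left) auto
  ultimately show ?thesis by (simp add: L2_set_def)
qed

lemma expectation_abs_std_gaussian_linear:
  assumes I: "finite I"
  shows "(\<integral>\<gamma>. \<bar>\<Sum>i\<in>I. \<gamma> i * v i\<bar> \<partial>std_gaussian I) = sqrt (2 / pi) * L2_set v I"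
proof (cases "\<forall>i\<in>I. v i = 0")
  case True
  then have "L2_set v I = 0" by (simp add: L2_set_eq_0_iff I)
  then show ?thesis using True by simp
next
  case False
  then obtain i0 where i0: "i0 \<in> I" "v i0 \<noteq> 0" by blast
  have pos: "L2_set v I > 0"
    using i0 I by (metis L2_set_eq_0_iff L2_set_nonneg less_eq_real_def)
  have "(\<integral>\<gamma>. \<bar>\<Sum>i\<in>I. \<gamma> i * v i\<bar> \<partial>std_gaussian I) = (\<integral>x. normal_density 0 (L2_set v I) x * \<bar>x\<bar> \<partial>lborel)"
    by (rule distributed_integral[OF distributed_std_gaussian_linear[where v=v, OF I i0], symmetric])
       (auto simp: normal_density_nonneg)
  also have "\<dots> = sqrt (2 / pi) * L2_set v I"
    using has_bochner_integral_integral_eq[OF normal_moment_abs_odd[OF pos, of 0 0]] by simp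
  finally show ?thesis .
qed

lemma distr_uminus_std_gaussian:
  assumes I: "finite I"
  shows "distr (std_gaussian I) (std_gaussian I) (\<lambda>\<gamma>. \<lambda>i\<in>I. - \<gamma> i) = std_gaussian I"
proof -
  have "distr std_normal std_normal uminus = distr std_normal lborel (\<lambda>x. (-1) * x)"
    by (intro distr_cong) auto
  also have "\<dots> = std_normal" by (subst distr_scaled_std_normal) auto
  finally have 1: "distr std_normal std_normal uminus = std_normal" .
  have "distr (std_gaussian I) (std_gaussian I) (compose I uminus) = std_gaussian I"
    by (subst distr_PiM_finite_prob_space'[OF I]) (auto simp: 1 prob_space_std_normal)
  then show ?thesis by (simp add: compose_def[abs_def])
qed

text \<open>Stability of the Gaussian law, coordinate by coordinate with individual scales: variances add.\<close>

lemma std_gaussian_add: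
  fixes h :: "('i \<Rightarrow> real) \<Rightarrow> real"
  assumes I: "finite I" and s: "\<And>i. i \<in> I \<Longrightarrow> 0 \<le> s i" and t: "\<And>i. i \<in> I \<Longrightarrow> 0 \<le> t i"
    and h: "h \<in> borel_measurable (PiM I (\<lambda>_. borel))"
    and int: "integrable (std_gaussian I) (\<lambda>\<gamma>. h (\<lambda>i\<in>I. sqrt ((s i)\<^sup>2 + (t i)\<^sup>2) * \<gamma> i))"
  shows "integrable (std_gaussian I) (\<lambda>\<gamma>. \<integral>\<gamma>'. h (\<lambda>i\<in>I. s i * \<gamma> i + t i * \<gamma>' i) \<partial>std_gaussian I)"
    and "(\<integral>\<gamma>. (\<integral>\<gamma>'. h (\<lambda>i\<in>I. s i * \<gamma> i + t i * \<gamma>' i) \<partial>std_gaussian I) \<partial>std_gaussian I)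
      = (\<integral>\<gamma>. h (\<lambda>i\<in>I. sqrt ((s i)\<^sup>2 + (t i)\<^sup>2) * \<gamma> i) \<partial>std_gaussian I)"
proof -
  interpret G: prob_space "std_gaussian I" by (rule prob_space_std_gaussian)
  interpret GG: pair_prob_space "std_gaussian I" "std_gaussian I" ..
  let ?B = "PiM I (\<lambda>_. borel) :: ('i \<Rightarrow> real) measure"
  let ?a = "\<lambda>(\<gamma>, \<gamma>'). \<lambda>i\<in>I. s i * \<gamma> i + t i * \<gamma>' i :: real"
  let ?b = "\<lambda>\<gamma>. \<lambda>i\<in>I. sqrt ((s i)\<^sup>2 + (t i)\<^sup>2) * \<gamma> i :: real"
  let ?D = "PiM I (\<lambda>i. distr std_normal borel (\<lambda>x. sqrt ((s i)\<^sup>2 + (t i)\<^sup>2) * x))"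
  have a: "?a \<in> measurable (std_gaussian I \<Otimes>\<^sub>M std_gaussian I) ?B"
    by (auto simp: case_prod_beta' intro!: measurable_restrict)
  have b: "?b \<in> measurable (std_gaussian I) ?B" by (intro measurable_restrict) auto
  have "distr (std_gaussian I \<Otimes>\<^sub>M std_gaussian I) ?B ?a
      = PiM I (\<lambda>i. distr (std_normal \<Otimes>\<^sub>M std_normal) borel (\<lambda>(x, y). s i * x + t i * y))"
    using distr_zip_PiM[OF I, of "\<lambda>_. std_normal" "\<lambda>_. std_normal" "\<lambda>i (x, y). s i * x + t i * y" "\<lambda>_. borel"]
    by (simp add: prob_space_std_normal)
  also have "\<dots> = ?D" by (intro PiM_cong refl distr_add_std_normal s t)
  finally have D1: "distr (std_gaussian I \<Otimes>\<^sub>M std_gaussian I) ?B ?a = ?D" .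
  \<comment> \<open>The law of one scaled Gaussian vector, seen as a function of two vectors that ignores the second.\<close>
  have "distr (std_gaussian I \<Otimes>\<^sub>M std_gaussian I) ?B (\<lambda>(x, y). \<lambda>i\<in>I. (\<lambda>(x,y). sqrt ((s i)\<^sup>2 + (t i)\<^sup>2) * x) (x i, y i))
      = PiM I (\<lambda>i. distr (std_normal \<Otimes>\<^sub>M std_normal) borel (\<lambda>(x, y). sqrt ((s i)\<^sup>2 + (t i)\<^sup>2) * x))"
    by (rule distr_zip_PiM[OF I]) (auto simp: prob_space_std_normal)
  also have "\<dots> = ?D"
  proof (intro PiM_cong refl)
    fix i assume "i \<in> I"
    have "distr (std_normal \<Otimes>\<^sub>M std_normal) borel (\<lambda>(x, y). sqrt ((s i)\<^sup>2 + (t i)\<^sup>2) * x)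
       = distr (std_normal \<Otimes>\<^sub>M std_normal) borel (\<lambda>(x, y). sqrt ((s i)\<^sup>2 + (t i)\<^sup>2) * x + 0 * y)" by simp
    also have "\<dots> = distr std_normal borel (\<lambda>x. sqrt ((s i)\<^sup>2 + (t i)\<^sup>2) * x)"
      by (subst distr_add_std_normal) auto
    finally show "distr (std_normal \<Otimes>\<^sub>M std_normal) borel (\<lambda>(x, y). sqrt ((s i)\<^sup>2 + (t i)\<^sup>2) * x)
       = distr std_normal borel (\<lambda>x. sqrt ((s i)\<^sup>2 + (t i)\<^sup>2) * x)" .
  qed
  also have "distr (std_gaussian I \<Otimes>\<^sub>M std_gaussian I) ?B (\<lambda>(x, y). \<lambda>i\<in>I. (\<lambda>(x,y). sqrt ((s i)\<^sup>2 + (t i)\<^sup>2) * x) (x i, y i))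
     = distr (std_gaussian I \<Otimes>\<^sub>M std_gaussian I) ?B (?b \<circ> fst)"
    by (intro distr_cong) auto
  also have "\<dots> = distr (distr (std_gaussian I \<Otimes>\<^sub>M std_gaussian I) (std_gaussian I) fst) ?B ?b"
    by (subst distr_distr[OF b]) auto
  also have "\<dots> = distr (std_gaussian I) ?B ?b" by (simp add: G.distr_pair_fst)
  finally have D2: "distr (std_gaussian I) ?B ?b = ?D" .
  have "integrable (distr (std_gaussian I \<Otimes>\<^sub>M std_gaussian I) ?B ?a) h"
    using int unfolding D1 D2[symmetric] by (subst integrable_distr_eq[OF b h])
  then have i1: "integrable (std_gaussian I \<Otimes>\<^sub>M std_gaussian I) (\<lambda>p. h (?a p))"
    by (subst (asm) integrable_distr_eq[OF a h])
  show "integrable (std_gaussian I) (\<lambda>\<gamma>. \<integral>\<gamma>'. h (\<lambda>i\<in>I. s i * \<gamma> i + t i * \<gamma>' i) \<partial>std_gaussian I)"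
    using GG.integrable_fst'[OF i1] by simp
  have "(\<integral>\<gamma>. (\<integral>\<gamma>'. h (?a (\<gamma>, \<gamma>')) \<partial>std_gaussian I) \<partial>std_gaussian I)
     = (\<integral>p. h (?a p) \<partial>(std_gaussian I \<Otimes>\<^sub>M std_gaussian I))"
    by (rule GG.integral_fst'[OF i1])
  also have "\<dots> = (\<integral>x. h x \<partial>?D)"
    unfolding D1[symmetric] by (rule integral_distr[OF a h, symmetric])
  also have "\<dots> = (\<integral>\<gamma>. h (?b \<gamma>) \<partial>std_gaussian I)"
    unfolding D2[symmetric] by (rule integral_distr[OF b h])
  finally show "(\<integral>\<gamma>. (\<integral>\<gamma>'. h (\<lambda>i\<in>I. s i * \<gamma> i + t i * \<gamma>' i) \<partial>std_gaussian I) \<partial>std_gaussian I)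
      = (\<integral>\<gamma>. h (\<lambda>i\<in>I. sqrt ((s i)\<^sup>2 + (t i)\<^sup>2) * \<gamma> i) \<partial>std_gaussian I)" by simp
qed

section \<open>Comparing processes on the discrete cube with Gaussian processes\<close>

text \<open>This replaces one random sign by a Gaussian vector. Let \<open>f\<close> and \<open>g\<close> attain the two suprema on
  the left and let \<open>V = W f - W g\<close>, where \<open>W f\<close> is the Gaussian sum belonging to \<open>f\<close>. The average
  on the left is \<open>(z f + z g + (a f - a g)) / 2\<close>. For \<open>W\<close> and \<open>-W\<close> together, the sum of the two
  suprema of \<open>z + W\<close> and \<open>z - W\<close> is at least \<open>z f + z g + \<bar>V\<bar>\<close>, since either of \<open>f\<close>, \<open>g\<close> can be
  inserted in either of them. As \<open>W\<close> is symmetric and \<open>E \<bar>V\<bar> = sqrt (2 / \<pi>) \<parallel>w f - w g\<parallel>\<close>, the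
  claim follows.\<close>

lemma two_point_max_le_gaussian_max:
  fixes z a :: "'f \<Rightarrow> real" and w :: "'f \<Rightarrow> 'i \<Rightarrow> real"
  assumes I: "finite I" and F: "finite F" "F \<noteq> {}"
    and le: "\<And>f g. f \<in> F \<Longrightarrow> g \<in> F \<Longrightarrow> a f - a g \<le> sqrt (2 / pi) * L2_set (\<lambda>i. w f i - w g i) I"
  shows "((SUP f\<in>F. z f + a f) + (SUP f\<in>F. z f - a f)) / 2
    \<le> (\<integral>\<gamma>. (SUP f\<in>F. z f + (\<Sum>i\<in>I. \<gamma> i * w f i)) \<partial>std_gaussian I)"
proof -
  let ?S = "\<lambda>\<gamma>. SUP f\<in>F. z f + (\<Sum>i\<in>I. \<gamma> i * w f i)"
  let ?N = "\<lambda>\<gamma>::'i \<Rightarrow> real. \<lambda>i\<in>I. - \<gamma> i"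
  have N: "?N \<in> measurable (std_gaussian I) (std_gaussian I)" by (intro measurable_restrict) auto
  note intS = integrable_gaussian_max[OF I F, of z w]
  have neg: "(\<integral>\<gamma>. ?S (?N \<gamma>) \<partial>std_gaussian I) = (\<integral>\<gamma>. ?S \<gamma> \<partial>std_gaussian I)"
    using integral_distr[OF N, of ?S] intS unfolding distr_uminus_std_gaussian[OF I] by auto
  have intN: "integrable (std_gaussian I) (\<lambda>\<gamma>. ?S (?N \<gamma>))"
    using integrable_distr_eq[OF N, of ?S] intS unfolding distr_uminus_std_gaussian[OF I] by auto
  obtain f where f: "f \<in> F" "(SUP f\<in>F. z f + a f) = z f + a f" using SUP_finite_attained[OF F] .
  obtain g where g: "g \<in> F" "(SUP f\<in>F. z f - a f) = z g - a g" using SUP_finite_attained[OF F] .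
  let ?V = "\<lambda>\<gamma>. \<Sum>i\<in>I. \<gamma> i * (w f i - w g i)"
  interpret prob_space "std_gaussian I" by (rule prob_space_std_gaussian)
  have iV: "integrable (std_gaussian I) (\<lambda>\<gamma>. \<bar>?V \<gamma>\<bar>)"
    by (intro integrable_abs integrable_std_gaussian_linear I)
  have "(SUP f\<in>F. z f + a f) + (SUP f\<in>F. z f - a f) = z f + z g + (a f - a g)" using f g by simp
  also have "\<dots> \<le> z f + z g + (\<integral>\<gamma>. \<bar>?V \<gamma>\<bar> \<partial>std_gaussian I)"
    unfolding expectation_abs_std_gaussian_linear[OF I] using le[OF f(1) g(1)] by simp
  also have "\<dots> = (\<integral>\<gamma>. z f + z g + \<bar>?V \<gamma>\<bar> \<partial>std_gaussian I)"
    by (simp add: iV prob_space)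
  also have "\<dots> \<le> (\<integral>\<gamma>. ?S \<gamma> + ?S (?N \<gamma>) \<partial>std_gaussian I)"
  proof (intro integral_mono Bochner_Integration.integrable_add intS intN integrable_const iV)
    fix \<gamma> :: "'i \<Rightarrow> real"
    have up: "z h + (\<Sum>i\<in>I. \<gamma> i * w h i) \<le> ?S \<gamma>" if "h \<in> F" for h
      by (rule SUP_finite_upper[OF F(1) that])
    have dn: "z h - (\<Sum>i\<in>I. \<gamma> i * w h i) \<le> ?S (?N \<gamma>)" if "h \<in> F" for h
      using SUP_finite_upper[OF F(1) that, of "\<lambda>f. z f + (\<Sum>i\<in>I. ?N \<gamma> i * w f i)"]
      by (simp add: sum_negf cong: sum.cong)
    have "?V \<gamma> = (\<Sum>i\<in>I. \<gamma> i * w f i) - (\<Sum>i\<in>I. \<gamma> i * w g i)"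
      by (simp add: sum_subtractf right_diff_distrib)
    then show "z f + z g + \<bar>?V \<gamma>\<bar> \<le> ?S \<gamma> + ?S (?N \<gamma>)"
      using up[OF f(1)] up[OF g(1)] dn[OF f(1)] dn[OF g(1)] by linarith
  qed
  also have "\<dots> = 2 * (\<integral>\<gamma>. ?S \<gamma> \<partial>std_gaussian I)"
    using intS intN neg by simp
  finally show ?thesis by simp
qed

text \<open>The weights \<open>q\<close> are variances, so that they add when independent Gaussian vectors are added.
  The shift \<open>z\<close> holds the part of the process that is not yet replaced by a Gaussian.\<close>

definition shifted_gaussian_max ::
  "'i set \<Rightarrow> 'f set \<Rightarrow> ('f \<Rightarrow> 'i \<Rightarrow> real) \<Rightarrow> ('i \<Rightarrow> real) \<Rightarrow> ('f \<Rightarrow> real) \<Rightarrow> real" where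
  "shifted_gaussian_max I F t q z =
     (\<integral>\<gamma>. (SUP f\<in>F. z f + (\<Sum>i\<in>I. \<gamma> i * (sqrt (q i) * t f i))) \<partial>std_gaussian I)"

text \<open>The preceding comparison in the presence of a Gaussian vector with variances \<open>q\<close>: it is applied
  for each value of that vector, with the shift \<open>z\<close> plus the Gaussian sum, and produces a second,
  independent vector with variances \<open>c\<close>.\<close>

lemma two_point_average_shifted_gaussian_max:
  fixes z a :: "'f \<Rightarrow> real" and t :: "'f \<Rightarrow> 'i \<Rightarrow> real"
  assumes I: "finite I" and F: "finite F" "F \<noteq> {}"
    and q: "\<And>i. i \<in> I \<Longrightarrow> 0 \<le> q i" and c: "\<And>i. i \<in> I \<Longrightarrow> 0 \<le> c i"
    and le: "\<And>f g. f \<in> F \<Longrightarrow> g \<in> F \<Longrightarrow> a f - a g \<le> sqrt (2 / pi) * sqrt (\<Sum>i\<in>I. c i * (t f i - t g i)\<^sup>2)"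
  shows "(shifted_gaussian_max I F t q (\<lambda>f. z f + a f) + shifted_gaussian_max I F t q (\<lambda>f. z f - a f)) / 2
    \<le> shifted_gaussian_max I F t (\<lambda>i. q i + c i) z"
proof -
  define h where "h x = (SUP f\<in>F. z f + (\<Sum>i\<in>I. x i * t f i))" for x :: "'i \<Rightarrow> real"
  have hm: "h \<in> borel_measurable (PiM I (\<lambda>_. borel))"
    unfolding h_def by (rule borel_measurable_cSUP) (use F in \<open>auto intro: countable_finite\<close>)
  have hcong: "h (\<lambda>i\<in>I. x i) = h x" for x
    unfolding h_def by (simp cong: sum.cong)
  have hq: "h (\<lambda>i\<in>I. sqrt ((sqrt (q i))\<^sup>2 + (sqrt (c i))\<^sup>2) * \<gamma> i)
     = (SUP f\<in>F. z f + (\<Sum>i\<in>I. \<gamma> i * (sqrt (q i + c i) * t f i)))" for \<gamma>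
    unfolding h_def using q c by (simp add: ac_simps cong: sum.cong)
  have int: "integrable (std_gaussian I) (\<lambda>\<gamma>. h (\<lambda>i\<in>I. sqrt ((sqrt (q i))\<^sup>2 + (sqrt (c i))\<^sup>2) * \<gamma> i))"
    unfolding hq by (rule integrable_gaussian_max[OF I F])
  note add = std_gaussian_add[OF I _ _ hm int]
  let ?P = "\<lambda>\<gamma>. SUP f\<in>F. z f + a f + (\<Sum>i\<in>I. \<gamma> i * (sqrt (q i) * t f i))"
  let ?M = "\<lambda>\<gamma>. SUP f\<in>F. z f - a f + (\<Sum>i\<in>I. \<gamma> i * (sqrt (q i) * t f i))"
  have iP: "integrable (std_gaussian I) ?P" and iM: "integrable (std_gaussian I) ?M"
    by (rule integrable_gaussian_max[OF I F])+
  have "(shifted_gaussian_max I F t q (\<lambda>f. z f + a f) + shifted_gaussian_max I F t q (\<lambda>f. z f - a f)) / 2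
     = (\<integral>\<gamma>. (?P \<gamma> + ?M \<gamma>) / 2 \<partial>std_gaussian I)"
    unfolding shifted_gaussian_max_def by (simp add: iP iM)
  also have "\<dots> \<le> (\<integral>\<gamma>. (\<integral>\<gamma>'. h (\<lambda>i\<in>I. sqrt (q i) * \<gamma> i + sqrt (c i) * \<gamma>' i) \<partial>std_gaussian I) \<partial>std_gaussian I)"
  proof (rule integral_mono)
    fix \<gamma> :: "'i \<Rightarrow> real"
    define y where "y f = z f + (\<Sum>i\<in>I. \<gamma> i * (sqrt (q i) * t f i))" for f
    have "(?P \<gamma> + ?M \<gamma>) / 2 = ((SUP f\<in>F. y f + a f) + (SUP f\<in>F. y f - a f)) / 2"
      by (simp add: y_def algebra_simps)
    also have "\<dots> \<le> (\<integral>\<gamma>'. (SUP f\<in>F. y f + (\<Sum>i\<in>I. \<gamma>' i * (sqrt (c i) * t f i))) \<partial>std_gaussian I)"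
    proof (rule two_point_max_le_gaussian_max[OF I F])
      fix f g assume fg: "f \<in> F" "g \<in> F"
      have "L2_set (\<lambda>i. sqrt (c i) * t f i - sqrt (c i) * t g i) I = sqrt (\<Sum>i\<in>I. c i * (t f i - t g i)\<^sup>2)"
        unfolding L2_set_def
        by (intro arg_cong[of _ _ sqrt] sum.cong refl) (simp add: power_mult_distrib c flip: right_diff_distrib)
      with le[OF fg] show "a f - a g \<le> sqrt (2 / pi) * L2_set (\<lambda>i. sqrt (c i) * t f i - sqrt (c i) * t g i) I"
        by simp
    qed
    also have "\<dots> = (\<integral>\<gamma>'. h (\<lambda>i\<in>I. sqrt (q i) * \<gamma> i + sqrt (c i) * \<gamma>' i) \<partial>std_gaussian I)"
      unfolding hcong h_def y_def by (simp add: algebra_simps sum.distrib)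
    finally show "(?P \<gamma> + ?M \<gamma>) / 2 \<le> (\<integral>\<gamma>'. h (\<lambda>i\<in>I. sqrt (q i) * \<gamma> i + sqrt (c i) * \<gamma>' i) \<partial>std_gaussian I)" .
  qed (use iP iM q c in \<open>auto intro!: add(1)\<close>)
  also have "\<dots> = shifted_gaussian_max I F t (\<lambda>i. q i + c i) z"
    using q c by (subst add(2)) (simp_all add: hq shifted_gaussian_max_def)
  finally show ?thesis .
qed

lemma sum_Pow_insert:
  assumes "finite K" "k \<notin> K"
  shows "(\<Sum>A\<in>Pow (insert k K). h A) = (\<Sum>A\<in>Pow K. h A + h (insert k A))"
proof -
  have "inj_on (insert k) (Pow K)" using assms(2) by (auto simp: inj_on_def)
  moreover have "Pow K \<inter> insert k ` Pow K = {}" using assms(2) by auto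
  ultimately show ?thesis
    using assms(1) by (simp add: Pow_insert sum.union_disjoint sum.reindex sum.distrib)
qed

text \<open>By induction over the coordinates of the cube of all subsets of \<open>K\<close>. Averaging \<open>\<Psi>\<close> over the
  membership of \<open>k\<close> leaves a process on the smaller cube, whose discrete derivatives satisfy the
  same bounds, and the random sign in front of the \<open>k\<close>-th discrete derivative becomes a Gaussian
  vector with variances \<open>c k\<close>. It is essential that the bound on the discrete derivative is
  uniform in \<open>A\<close>: then the new Gaussian vector does not depend on the remaining coordinates.\<close>

lemma hypercube_average_shifted_gaussian_max:
  fixes \<Psi> :: "'f \<Rightarrow> 'k set \<Rightarrow> real" and t :: "'f \<Rightarrow> 'i \<Rightarrow> real" and c :: "'k \<Rightarrow> 'i \<Rightarrow> real"
  assumes K: "finite K" and I: "finite I" and F: "finite F" "F \<noteq> {}"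
    and q: "\<And>i. i \<in> I \<Longrightarrow> 0 \<le> q i" and c: "\<And>k i. k \<in> K \<Longrightarrow> i \<in> I \<Longrightarrow> 0 \<le> c k i"
    and le: "\<And>k A f g. k \<in> K \<Longrightarrow> A \<subseteq> K - {k} \<Longrightarrow> f \<in> F \<Longrightarrow> g \<in> F \<Longrightarrow>
      ((\<Psi> f (insert k A) - \<Psi> f A) - (\<Psi> g (insert k A) - \<Psi> g A)) / 2
        \<le> sqrt (2 / pi) * sqrt (\<Sum>i\<in>I. c k i * (t f i - t g i)\<^sup>2)"
  shows "(\<Sum>A\<in>Pow K. shifted_gaussian_max I F t q (\<lambda>f. \<Psi> f A)) / 2 ^ card K
     \<le> shifted_gaussian_max I F t (\<lambda>i. q i + (\<Sum>k\<in>K. c k i)) (\<lambda>f. (\<Sum>A\<in>Pow K. \<Psi> f A) / 2 ^ card K)"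
  using K q c le
proof (induction K arbitrary: \<Psi> q rule: finite_induct)
  case empty
  then show ?case by simp
next
  case (insert k K)
  \<comment> \<open>The conditional expectation of the process when the membership of \<open>k\<close> is averaged out.\<close>
  define \<Psi>' where "\<Psi>' f A = (\<Psi> f A + \<Psi> f (insert k A)) / 2" for f A
  define q' where "q' i = q i + c k i" for i
  have step: "(shifted_gaussian_max I F t q (\<lambda>f. \<Psi> f A) + shifted_gaussian_max I F t q (\<lambda>f. \<Psi> f (insert k A))) / 2
      \<le> shifted_gaussian_max I F t q' (\<lambda>f. \<Psi>' f A)" if A: "A \<in> Pow K" for A
  proof -
    define a where "a f = (\<Psi> f (insert k A) - \<Psi> f A) / 2" for f
    have "(shifted_gaussian_max I F t q (\<lambda>f. \<Psi>' f A + a f) + shifted_gaussian_max I F t q (\<lambda>f. \<Psi>' f A - a f)) / 2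
      \<le> shifted_gaussian_max I F t (\<lambda>i. q i + c k i) (\<lambda>f. \<Psi>' f A)"
    proof (rule two_point_average_shifted_gaussian_max[OF I F])
      fix f g assume fg: "f \<in> F" "g \<in> F"
      have "A \<subseteq> insert k K - {k}" using A insert.hyps(2) by auto
      from insert.prems(3)[OF _ this fg]
      show "a f - a g \<le> sqrt (2 / pi) * sqrt (\<Sum>i\<in>I. c k i * (t f i - t g i)\<^sup>2)"
        by (simp add: a_def diff_divide_distrib)
    qed (use insert.prems in auto)
    moreover have "(\<lambda>f. \<Psi>' f A + a f) = (\<lambda>f. \<Psi> f (insert k A))" "(\<lambda>f. \<Psi>' f A - a f) = (\<lambda>f. \<Psi> f A)"
      by (auto simp: \<Psi>'_def a_def field_simps)
    ultimately show ?thesis by (simp add: q'_def[abs_def] add.commute)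
  qed
  have "(\<Sum>A\<in>Pow (insert k K). shifted_gaussian_max I F t q (\<lambda>f. \<Psi> f A)) / 2 ^ card (insert k K)
     = (\<Sum>A\<in>Pow K. (shifted_gaussian_max I F t q (\<lambda>f. \<Psi> f A) + shifted_gaussian_max I F t q (\<lambda>f. \<Psi> f (insert k A))) / 2) / 2 ^ card K"
    unfolding sum_Pow_insert[OF insert.hyps] using insert.hyps by (simp add: sum_divide_distrib)
  also have "\<dots> \<le> (\<Sum>A\<in>Pow K. shifted_gaussian_max I F t q' (\<lambda>f. \<Psi>' f A)) / 2 ^ card K"
    by (intro divide_right_mono sum_mono step) auto
  also have "\<dots> \<le> shifted_gaussian_max I F t (\<lambda>i. q' i + (\<Sum>k\<in>K. c k i)) (\<lambda>f. (\<Sum>A\<in>Pow K. \<Psi>' f A) / 2 ^ card K)"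
  proof (rule insert.IH)
    fix j A f g assume j: "j \<in> K" and A: "A \<subseteq> K - {j}" and fg: "f \<in> F" "g \<in> F"
    have jk: "j \<noteq> k" using j insert.hyps(2) by auto
    have "((\<Psi> f (insert j A) - \<Psi> f A) - (\<Psi> g (insert j A) - \<Psi> g A)) / 2
        \<le> sqrt (2 / pi) * sqrt (\<Sum>i\<in>I. c j i * (t f i - t g i)\<^sup>2)"
      by (rule insert.prems(3)) (use j A fg in auto)
    moreover have "((\<Psi> f (insert j (insert k A)) - \<Psi> f (insert k A)) - (\<Psi> g (insert j (insert k A)) - \<Psi> g (insert k A))) / 2
        \<le> sqrt (2 / pi) * sqrt (\<Sum>i\<in>I. c j i * (t f i - t g i)\<^sup>2)"
      by (rule insert.prems(3)) (use j A fg jk in auto)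
    moreover have "insert j (insert k A) = insert k (insert j A)" by (rule insert_commute)
    ultimately show "((\<Psi>' f (insert j A) - \<Psi>' f A) - (\<Psi>' g (insert j A) - \<Psi>' g A)) / 2
        \<le> sqrt (2 / pi) * sqrt (\<Sum>i\<in>I. c j i * (t f i - t g i)\<^sup>2)"
      unfolding \<Psi>'_def by (simp add: field_simps)
  qed (use insert.prems in \<open>auto simp: q'_def\<close>)
  also have "(\<lambda>i. q' i + (\<Sum>k\<in>K. c k i)) = (\<lambda>i. q i + (\<Sum>k\<in>insert k K. c k i))"
    using insert.hyps by (auto simp: q'_def)
  also have "(\<lambda>f. (\<Sum>A\<in>Pow K. \<Psi>' f A) / 2 ^ card K) = (\<lambda>f. (\<Sum>A\<in>Pow (insert k K). \<Psi> f A) / 2 ^ card (insert k K))"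
    unfolding sum_Pow_insert[OF insert.hyps] \<Psi>'_def using insert.hyps
    by (auto simp: sum_divide_distrib)
  finally show ?case .
qed

section \<open>Symmetrized differences of a smooth function\<close>

definition mix :: "nat \<Rightarrow> nat set \<Rightarrow> (nat \<Rightarrow> 'a) \<Rightarrow> (nat \<Rightarrow> 'a) \<Rightarrow> nat \<Rightarrow> 'a" where
  "mix n A u v = (\<lambda>i\<in>{1..n}. if i \<in> A then v i else u i)"

lemma mix_Rn: "mix n A u v \<in> Rn n"
  by (auto simp: mix_def Rn_def)

lemma mix_insert: "k \<in> {1..n} \<Longrightarrow> mix n (insert k A) u v = (mix n A u v)(k := v k)"
  by (auto simp: mix_def)

lemma mix_delete: "k \<in> {1..n} \<Longrightarrow> mix n (A - {k}) u v = (mix n A u v)(k := u k)"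
  by (auto simp: mix_def)

lemma gaussian_average_eq_std_gaussian:
  "gaussian_average n (y ` F) = (\<integral>\<gamma>. (SUP f\<in>F. \<Sum>i\<in>{1..n}. \<gamma> i * y f i) \<partial>std_gaussian {1..n})"
  unfolding gaussian_average_def by (simp add: image_image)

lemma gaussian_average_nonneg:
  assumes "finite F" "F \<noteq> {}"
  shows "0 \<le> gaussian_average n (y ` F)"
proof -
  have "((SUP f\<in>F. 0 + 0) + (SUP f\<in>F. 0 - 0)) / 2
    \<le> (\<integral>\<gamma>. (SUP f\<in>F. (0::real) + (\<Sum>i\<in>{1..n}. \<gamma> i * y f i)) \<partial>std_gaussian {1..n})"
    by (rule two_point_max_le_gaussian_max) (use assms in auto)
  then show ?thesis using assms unfolding gaussian_average_eq_std_gaussian by simp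
qed

lemma std_gaussian_reindex:
  fixes p :: "'i \<Rightarrow> 'j"
  assumes I: "finite I" and p: "inj_on p I" "p \<in> I \<rightarrow> J" and F: "finite F" "F \<noteq> {}"
  shows "integrable (std_gaussian J) (\<lambda>\<gamma>. SUP f\<in>F. \<Sum>i\<in>I. \<gamma> (p i) * y f i)"
    and "(\<integral>\<gamma>. (SUP f\<in>F. \<Sum>i\<in>I. \<gamma> (p i) * y f i) \<partial>std_gaussian J)
        = (\<integral>\<gamma>. (SUP f\<in>F. \<Sum>i\<in>I. \<gamma> i * y f i) \<partial>std_gaussian I)"
proof -
  let ?p = "\<lambda>\<gamma>. \<lambda>i\<in>I. \<gamma> (p i)"
  have D: "distr (std_gaussian J) (std_gaussian I) ?p = std_gaussian I"
    using distr_PiM_reindex[of J "\<lambda>_. std_normal" p I] p prob_space_std_normal by simp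
  have m: "?p \<in> measurable (std_gaussian J) (std_gaussian I)"
    using p(2) by (intro measurable_restrict measurable_component_singleton) auto
  let ?h = "\<lambda>\<gamma>. SUP f\<in>F. \<Sum>i\<in>I. \<gamma> i * y f i"
  have int: "integrable (std_gaussian I) ?h"
    using integrable_gaussian_max[OF I F, of "\<lambda>_. 0" y] by simp
  have eq: "?h (?p \<gamma>) = (SUP f\<in>F. \<Sum>i\<in>I. \<gamma> (p i) * y f i)" for \<gamma> by (simp cong: sum.cong)
  have hm: "?h \<in> borel_measurable (std_gaussian I)" using int by auto
  show "integrable (std_gaussian J) (\<lambda>\<gamma>. SUP f\<in>F. \<Sum>i\<in>I. \<gamma> (p i) * y f i)"
    using int integrable_distr_eq[OF m hm] unfolding D eq by simp
  show "(\<integral>\<gamma>. (SUP f\<in>F. \<Sum>i\<in>I. \<gamma> (p i) * y f i) \<partial>std_gaussian J) = (\<integral>\<gamma>. ?h \<gamma> \<partial>std_gaussian I)"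
    using integral_distr[OF m hm] unfolding D eq by simp
qed

text \<open>The vector \<open>(f(x), f(x'))\<close> has \<open>2 n\<close> coordinates, indexed by a disjoint union. Its Gaussian
  average splits by subadditivity of the supremum, and each part involves only the marginal of
  the Gaussian vector on one copy of \<open>{1..n}\<close>.\<close>

lemma shifted_gaussian_max_Plus_le:
  assumes F: "finite F" "F \<noteq> {}" and s: "0 \<le> s"
  shows "shifted_gaussian_max ({1..n} <+> {1..n}) F (\<lambda>f. case_sum (y f) (y' f)) (\<lambda>_. s) (\<lambda>_. 0)
    \<le> sqrt s * (gaussian_average n (y ` F) + gaussian_average n (y' ` F))"
proof -
  let ?J = "{1..n} <+> {1..n}"
  let ?a = "\<lambda>f (\<gamma>::nat + nat \<Rightarrow> real). \<Sum>i\<in>{1..n}. \<gamma> (Inl i) * y f i"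
  let ?b = "\<lambda>f (\<gamma>::nat + nat \<Rightarrow> real). \<Sum>i\<in>{1..n}. \<gamma> (Inr i) * y' f i"
  have Inl: "inj_on Inl {1..n}" "Inl \<in> {1..n} \<rightarrow> ?J" and Inr: "inj_on Inr {1..n}" "Inr \<in> {1..n} \<rightarrow> ?J"
    by auto
  note a = std_gaussian_reindex[OF _ Inl F, of y]
  note b = std_gaussian_reindex[OF _ Inr F, of y']
  have "shifted_gaussian_max ?J F (\<lambda>f. case_sum (y f) (y' f)) (\<lambda>_. s) (\<lambda>_. 0)
     \<le> (\<integral>\<gamma>. sqrt s * ((SUP f\<in>F. ?a f \<gamma>) + (SUP f\<in>F. ?b f \<gamma>)) \<partial>std_gaussian ?J)"
    unfolding shifted_gaussian_max_def
  proof (rule integral_mono)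
    show "integrable (std_gaussian ?J)
        (\<lambda>\<gamma>. SUP f\<in>F. 0 + (\<Sum>i\<in>?J. \<gamma> i * (sqrt s * case_sum (y f) (y' f) i)))"
      by (rule integrable_gaussian_max) (use F in auto)
    show "integrable (std_gaussian ?J) (\<lambda>\<gamma>. sqrt s * ((SUP f\<in>F. ?a f \<gamma>) + (SUP f\<in>F. ?b f \<gamma>)))"
      using a(1) b(1) by simp
    fix \<gamma> :: "nat + nat \<Rightarrow> real"
    show "(SUP f\<in>F. 0 + (\<Sum>i\<in>?J. \<gamma> i * (sqrt s * case_sum (y f) (y' f) i)))
      \<le> sqrt s * ((SUP f\<in>F. ?a f \<gamma>) + (SUP f\<in>F. ?b f \<gamma>))"
    proof (rule cSUP_least)
      fix f assume f: "f \<in> F"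
      have "0 + (\<Sum>i\<in>?J. \<gamma> i * (sqrt s * case_sum (y f) (y' f) i)) = sqrt s * (?a f \<gamma> + ?b f \<gamma>)"
        by (subst sum.Plus) (simp_all add: distrib_left sum_distrib_left ac_simps)
      also have "\<dots> \<le> sqrt s * ((SUP f\<in>F. ?a f \<gamma>) + (SUP f\<in>F. ?b f \<gamma>))"
        using SUP_finite_upper[OF F(1) f, of "\<lambda>f. ?a f \<gamma>"] SUP_finite_upper[OF F(1) f, of "\<lambda>f. ?b f \<gamma>"] s
        by (intro mult_left_mono add_mono) auto
      finally show "0 + (\<Sum>i\<in>?J. \<gamma> i * (sqrt s * case_sum (y f) (y' f) i))
        \<le> sqrt s * ((SUP f\<in>F. ?a f \<gamma>) + (SUP f\<in>F. ?b f \<gamma>))" .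
    qed (use F in auto)
  qed
  also have "\<dots> = sqrt s * (gaussian_average n (y ` F) + gaussian_average n (y' ` F))"
    using a b unfolding gaussian_average_eq_std_gaussian by simp
  finally show ?thesis .
qed

lemma L2_set_mix_diff_le:
  assumes "finite I"
  shows "L2_set (\<lambda>l. (if l \<in> A then y' l else y l) - (if l \<in> A then z' l else z l)) (I - {k})
    \<le> sqrt (\<Sum>l\<in>I. (y l - z l)\<^sup>2 + (y' l - z' l :: real)\<^sup>2)"
  unfolding L2_set_def
proof (rule real_sqrt_le_mono)
  have "(\<Sum>l\<in>I - {k}. ((if l \<in> A then y' l else y l) - (if l \<in> A then z' l else z l))\<^sup>2)
     \<le> (\<Sum>l\<in>I - {k}. (y l - z l)\<^sup>2 + (y' l - z' l)\<^sup>2)"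
    by (intro sum_mono) auto
  also have "\<dots> \<le> (\<Sum>l\<in>I. (y l - z l)\<^sup>2 + (y' l - z' l)\<^sup>2)"
    using assms by (intro sum_mono2) auto
  finally show "(\<Sum>l\<in>I - {k}. ((if l \<in> A then y' l else y l) - (if l \<in> A then z' l else z l))\<^sup>2)
     \<le> (\<Sum>l\<in>I. (y l - z l)\<^sup>2 + (y' l - z' l)\<^sup>2)" .
qed

lemma sum_of_three_squared_le: "(a + b + c)\<^sup>2 \<le> 3 * (a\<^sup>2 + b\<^sup>2 + (c::real)\<^sup>2)"
proof -
  have "0 \<le> (a - b)\<^sup>2 + (b - c)\<^sup>2 + (a - c)\<^sup>2" by simp
  then show ?thesis by (simp add: power2_eq_square algebra_simps)
qed

text \<open>The process \<open>\<Psi> f A\<close> changes sign when \<open>A\<close> is replaced by its complement, so its mean over all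
  \<open>A\<close> is \<open>0\<close> and only the Gaussian part of the comparison remains. Inserting \<open>k\<close> into \<open>A\<close> changes
  coordinate \<open>k\<close> in opposite directions in the two terms of \<open>\<Psi>\<close>, so its discrete derivative is a
  sum of two increments of \<open>\<Phi>\<close>, each covered by the bound for mixed differences; the factor \<open>1 /
  2\<close> in the comparison makes up for there being two.\<close>

lemma hypercube_symmetrized_bound:
  fixes y y' :: "'f \<Rightarrow> nat \<Rightarrow> real"
  assumes td: "twice_differentiable_Rn n \<Phi>" and L: "first_order_bound n \<Phi> L"
    and M: "mixed_second_order_bound n \<Phi> M" and n: "n \<ge> 1"
    and F: "finite F" "F \<noteq> {}"
    and y: "\<And>f i. f \<in> F \<Longrightarrow> i \<in> {1..n} \<Longrightarrow> y f i \<in> {0..1}"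
    and y': "\<And>f i. f \<in> F \<Longrightarrow> i \<in> {1..n} \<Longrightarrow> y' f i \<in> {0..1}"
  shows "(\<Sum>A\<in>Pow {1..n}. SUP f\<in>F. \<Phi> (mix n A (y f) (y' f)) - \<Phi> (mix n ({1..n} - A) (y f) (y' f))) / 2 ^ n
    \<le> sqrt (3 * pi / 2) * (L + M) * (gaussian_average n (y ` F) + gaussian_average n (y' ` F))"
proof -
  let ?I = "{1..n} <+> {1..n}"
  define \<Psi> where "\<Psi> f A = \<Phi> (mix n A (y f) (y' f)) - \<Phi> (mix n ({1..n} - A) (y f) (y' f))" for f A
  define t where "t f = case_sum (y f) (y' f)" for f
  define J where "J k = interaction n \<Phi> k" for k
  have J0: "J k \<ge> 0" for k unfolding J_def by (rule interaction_nonneg)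
  \<comment> \<open>The factor \<open>3\<close> comes from squaring a sum of three terms, and \<open>\<pi> / 2\<close> cancels the Gaussian factor \<open>2 / \<pi>\<close>.\<close>
  define c where "c k i = 3 * pi / 2 * ((if i = Inl k \<or> i = Inr k then L\<^sup>2 else 0) + J k)" for k and i :: "nat + nat"
  have L0: "0 \<le> L" by (rule first_order_bound_nonneg[OF L n])
  have M0: "0 \<le> M" by (rule mixed_second_order_bound_nonneg[OF M])
  have le: "((\<Psi> f (insert k A) - \<Psi> f A) - (\<Psi> g (insert k A) - \<Psi> g A)) / 2
        \<le> sqrt (2 / pi) * sqrt (\<Sum>i\<in>?I. c k i * (t f i - t g i)\<^sup>2)"
    if k: "k \<in> {1..n}" and A: "A \<subseteq> {1..n} - {k}" and f: "f \<in> F" and g: "g \<in> F" for k A f g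
  proof -
    define S where "S = (\<Sum>l\<in>{1..n}. (y f l - y g l)\<^sup>2 + (y' f l - y' g l)\<^sup>2)"
    define B where "B = L * \<bar>y' f k - y' g k\<bar> + L * \<bar>y f k - y g k\<bar> + sqrt (J k) * sqrt S"
    have D: "\<bar>(\<Phi> ((mix n C (y f) (y' f))(k := y' f k)) - \<Phi> ((mix n C (y f) (y' f))(k := y f k)))
       - (\<Phi> ((mix n C (y g) (y' g))(k := y' g k)) - \<Phi> ((mix n C (y g) (y' g))(k := y g k)))\<bar> \<le> B" for C
    proof -
      have "L2_set (\<lambda>l. mix n C (y f) (y' f) l - mix n C (y g) (y' g) l) ({1..n} - {k})
         = L2_set (\<lambda>l. (if l \<in> C then y' f l else y f l) - (if l \<in> C then y' g l else y g l)) ({1..n} - {k})"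
        unfolding L2_set_def by (intro arg_cong[of _ _ sqrt] sum.cong) (auto simp: mix_def)
      also have "\<dots> \<le> sqrt S" unfolding S_def by (rule L2_set_mix_diff_le) simp
      finally have "sqrt (J k) * L2_set (\<lambda>l. mix n C (y f) (y' f) l - mix n C (y g) (y' g) l) ({1..n} - {k})
         \<le> sqrt (J k) * sqrt S" by (intro mult_left_mono) (auto simp: J0)
      with mixed_difference_le[OF td L M k mix_Rn mix_Rn, of "y g k" "y' g k" C "y f" "y' f" "y' f k" "y f k" C "y g" "y' g"]
      show ?thesis using y[OF g k] y'[OF g k] unfolding B_def J_def by simp
    qed
    have kA: "A - {k} = A" "({1..n} - insert k A) = ({1..n} - A) - {k}" "insert k ({1..n} - A) = {1..n} - A"
      using A k by auto
    have \<Psi>diff: "\<Psi> h (insert k A) - \<Psi> h A =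
         (\<Phi> ((mix n A (y h) (y' h))(k := y' h k)) - \<Phi> ((mix n A (y h) (y' h))(k := y h k)))
       + (\<Phi> ((mix n ({1..n} - A) (y h) (y' h))(k := y' h k)) - \<Phi> ((mix n ({1..n} - A) (y h) (y' h))(k := y h k)))" for h
      unfolding \<Psi>_def mix_insert[OF k, symmetric] mix_delete[OF k, symmetric] kA(1) kA(2)[symmetric] kA(3) by simp
    have "((\<Psi> f (insert k A) - \<Psi> f A) - (\<Psi> g (insert k A) - \<Psi> g A)) / 2 \<le> B"
      unfolding \<Psi>diff using D[of A] D[of "{1..n} - A"] by argo
    also have "B \<le> sqrt (2 / pi * (\<Sum>i\<in>?I. c k i * (t f i - t g i)\<^sup>2))"
    proof (rule real_le_rsqrt)
      have S0: "S \<ge> 0" unfolding S_def by (intro sum_nonneg) auto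
      have "B\<^sup>2 \<le> 3 * ((L * \<bar>y' f k - y' g k\<bar>)\<^sup>2 + (L * \<bar>y f k - y g k\<bar>)\<^sup>2 + (sqrt (J k) * sqrt S)\<^sup>2)"
        unfolding B_def by (rule sum_of_three_squared_le)
      also have "\<dots> = 3 * (L\<^sup>2 * (y f k - y g k)\<^sup>2 + L\<^sup>2 * (y' f k - y' g k)\<^sup>2 + J k * S)"
        using S0 J0 by (simp add: power_mult_distrib)
      also have "\<dots> = 3 * ((\<Sum>l\<in>{1..n}. ((if l = k then L\<^sup>2 else 0) + J k) * (y f l - y g l)\<^sup>2)
          + (\<Sum>l\<in>{1..n}. ((if l = k then L\<^sup>2 else 0) + J k) * (y' f l - y' g l)\<^sup>2))"
        using k by (simp add: S_def distrib_right sum.distrib distrib_left sum_distrib_left if_distrib[of "\<lambda>x. x * _"] cong: if_cong)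
      also have "\<dots> = 2 / pi * (\<Sum>i\<in>?I. c k i * (t f i - t g i)\<^sup>2)"
        by (subst sum.Plus, simp, simp)
          (auto simp: c_def t_def sum_distrib_left field_simps intro!: arg_cong2[where f = "(+)"] sum.cong)
      finally show "B\<^sup>2 \<le> 2 / pi * (\<Sum>i\<in>?I. c k i * (t f i - t g i)\<^sup>2)" .
    qed
    finally show ?thesis by (simp only: real_sqrt_mult)
  qed
  \<comment> \<open>The sum of the variances \<open>c k i\<close> over \<open>k\<close>, which is the same for all \<open>i\<close>.\<close>
  define s where "s = 3 * pi / 2 * (L\<^sup>2 + (\<Sum>k=1..n. J k))"
  have s0: "0 \<le> s" unfolding s_def by (intro mult_nonneg_nonneg add_nonneg_nonneg sum_nonneg J0) auto
  have csum: "(\<Sum>k\<in>{1..n}. c k i) = s" if "i \<in> ?I" for i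
  proof -
    have "(\<Sum>k\<in>{1..n}. if i = Inl k \<or> i = Inr k then L\<^sup>2 else 0) = L\<^sup>2"
      using that by (cases i) auto
    then show ?thesis unfolding c_def s_def sum_distrib_left[symmetric] sum.distrib by simp
  qed
  have zero: "(\<Sum>A\<in>Pow {1..n}. \<Psi> f A) = 0" for f
  proof -
    have "(\<Sum>A\<in>Pow {1..n}. \<Phi> (mix n ({1..n} - A) (y f) (y' f))) = (\<Sum>A\<in>Pow {1..n}. \<Phi> (mix n A (y f) (y' f)))"
      by (rule sum.reindex_bij_witness[where i = "\<lambda>A. {1..n} - A" and j = "\<lambda>A. {1..n} - A"]) auto
    then show ?thesis unfolding \<Psi>_def by (simp add: sum_subtractf)
  qed
  have G0: "shifted_gaussian_max ?I F t (\<lambda>_. 0) (\<lambda>f. \<Psi> f A) = (SUP f\<in>F. \<Psi> f A)" for A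
    unfolding shifted_gaussian_max_def by (simp add: prob_space.prob_space[OF prob_space_std_gaussian])
  have "(\<Sum>A\<in>Pow {1..n}. SUP f\<in>F. \<Psi> f A) / 2 ^ n
      = (\<Sum>A\<in>Pow {1..n}. shifted_gaussian_max ?I F t (\<lambda>_. 0) (\<lambda>f. \<Psi> f A)) / 2 ^ card {1..n}"
    unfolding G0 by simp
  also have "\<dots> \<le> shifted_gaussian_max ?I F t (\<lambda>i. 0 + (\<Sum>k\<in>{1..n}. c k i)) (\<lambda>f. (\<Sum>A\<in>Pow {1..n}. \<Psi> f A) / 2 ^ card {1..n})"
    by (rule hypercube_average_shifted_gaussian_max) (use F le J0 in \<open>auto simp: c_def\<close>)
  also have "\<dots> = shifted_gaussian_max ?I F t (\<lambda>_. s) (\<lambda>_. 0)"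
    unfolding shifted_gaussian_max_def zero by (simp add: csum[unfolded One_nat_def] cong: sum.cong)
  also have "\<dots> \<le> sqrt s * (gaussian_average n (y ` F) + gaussian_average n (y' ` F))"
    unfolding t_def by (rule shifted_gaussian_max_Plus_le[OF F s0])
  also have "\<dots> \<le> sqrt (3 * pi / 2) * (L + M) * (gaussian_average n (y ` F) + gaussian_average n (y' ` F))"
  proof (rule mult_right_mono)
    have "L\<^sup>2 + (\<Sum>k=1..n. J k) \<le> (L + M)\<^sup>2"
      using sum_interaction_le[OF M] mult_nonneg_nonneg[OF L0 M0] unfolding J_def power2_sum by linarith
    then have "sqrt s \<le> sqrt (3 * pi / 2 * (L + M)\<^sup>2)"
      unfolding s_def by (intro real_sqrt_le_mono mult_left_mono) auto
    then show "sqrt s \<le> sqrt (3 * pi / 2) * (L + M)"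
      unfolding real_sqrt_mult[of "3 * pi / 2" "(L + M)\<^sup>2"] using L0 M0 by simp
  qed (intro add_nonneg_nonneg gaussian_average_nonneg F)
  finally show ?thesis unfolding \<Psi>_def .
qed

section \<open>Symmetrization\<close>

text \<open>The vectors in \<open>Rn n\<close> are extensional functions, so \<open>\<Phi>\<close> itself need not be continuous for the
  product topology on \<open>nat \<Rightarrow> real\<close>. Its composition with the restriction to \<open>{1..n}\<close> is
  continuous, and the extension by \<open>0\<close> carries measurability back.\<close>

lemma Lipschitz_borel_measurable:
  assumes Lip: "\<And>u v. u \<in> Rn n \<Longrightarrow> v \<in> Rn n \<Longrightarrow> \<bar>\<Phi> v - \<Phi> u\<bar> \<le> L * (\<Sum>i=1..n. \<bar>v i - u i\<bar>)"
  shows "\<Phi> \<in> borel_measurable (PiM {1..n} (\<lambda>_. borel))"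
proof -
  define \<Phi>' where "\<Phi>' x = \<Phi> (restrict x {1..n})" for x :: "nat \<Rightarrow> real"
  have cont: "continuous_on UNIV \<Phi>'"
    unfolding continuous_on_def
  proof
    fix u :: "nat \<Rightarrow> real"
    have coord: "((\<lambda>v::nat \<Rightarrow> real. v i) \<longlongrightarrow> u i) (at u)" for i
    proof -
      have "continuous_on UNIV (\<lambda>v::nat \<Rightarrow> real. v i)" by (rule continuous_on_product_coordinates)
      then show ?thesis unfolding continuous_on_def by simp
    qed
    have lim: "((\<lambda>v. L * (\<Sum>i=1..n. \<bar>v i - u i\<bar>)) \<longlongrightarrow> L * (\<Sum>i=1..n. \<bar>u i - u i\<bar>)) (at u)"
      by (intro tendsto_intros coord)
    have "\<bar>\<Phi>' v - \<Phi>' u\<bar> \<le> L * (\<Sum>i=1..n. \<bar>v i - u i\<bar>)" for v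
      using Lip[of "restrict u {1..n}" "restrict v {1..n}"] unfolding \<Phi>'_def by (simp add: Rn_def)
    then have "((\<lambda>v. \<Phi>' v - \<Phi>' u) \<longlongrightarrow> 0) (at u)"
      using lim by (intro Lim_null_comparison[OF _ lim[simplified]]) (auto intro!: always_eventually)
    then show "(\<Phi>' \<longlongrightarrow> \<Phi>' u) (at u within UNIV)" by (simp add: LIM_zero_iff)
  qed
  define e where "e x = (\<lambda>i. if i \<in> {1..n} then x i else 0)" for x :: "nat \<Rightarrow> real"
  have e: "e \<in> measurable (PiM {1..n} (\<lambda>_. borel)) (PiM UNIV (\<lambda>_. borel))"
  proof (rule measurable_PiM_single')
    fix i
    show "(\<lambda>x. e x i) \<in> borel_measurable (PiM {1..n} (\<lambda>_. borel))"
      unfolding e_def by (cases "i \<in> {1..n}") auto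
  qed auto
  have "\<Phi>' \<in> borel_measurable (PiM UNIV (\<lambda>_. borel))"
    using borel_measurable_continuous_onI[OF cont] by (simp cong: measurable_cong_sets add: sets_PiM_equal_borel)
  from measurable_compose[OF e this] have "(\<lambda>x. \<Phi>' (e x)) \<in> borel_measurable (PiM {1..n} (\<lambda>_. borel))" .
  moreover have "\<Phi>' (e x) = \<Phi> x" if "x \<in> space (PiM {1..n} (\<lambda>_. borel))" for x
  proof -
    have "restrict (e x) {1..n} = x"
      using that by (auto simp: e_def space_PiM PiE_def extensional_def)
    then show ?thesis by (simp add: \<Phi>'_def)
  qed
  ultimately show ?thesis by (subst measurable_cong[of _ _ "\<lambda>x. \<Phi>' (e x)"]) auto
qed

text \<open>Zipping \<open>(x, x')\<close> gives a vector of independent pairs, and the exchange of the components of a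
  pair preserves its law because both have the law \<open>\<mu> i\<close>.\<close>

lemma distr_swap_coordinates:
  assumes \<mu>: "\<And>i. i \<in> {1..n} \<Longrightarrow> prob_space (\<mu> i)"
  defines "P \<equiv> PiM {1..n} \<mu>"
  shows "distr (P \<Otimes>\<^sub>M P) (P \<Otimes>\<^sub>M P) (\<lambda>(x, x'). (mix n A x x', mix n A x' x)) = P \<Otimes>\<^sub>M P"
proof -
  define Q where "Q = PiM {1..n} (\<lambda>i. \<mu> i \<Otimes>\<^sub>M \<mu> i)"
  define sw where "sw i = (\<lambda>(a, b). if i \<in> A then (b, a) else (a, b) :: 'a \<times> 'a)" for i
  define zip where "zip = (\<lambda>(x, x'). \<lambda>i\<in>{1..n}. (x i, x' i) :: 'a \<times> 'a)"
  define unzip where "unzip z = (\<lambda>i\<in>{1..n}. fst (z i), \<lambda>i\<in>{1..n}. snd (z i))" for z :: "nat \<Rightarrow> 'a \<times> 'a"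
  have pair: "pair_sigma_finite (\<mu> i) (\<mu> i)" if "i \<in> {1..n}" for i
    unfolding pair_sigma_finite_def using \<mu>[OF that] by (auto intro: prob_space_imp_sigma_finite)
  have swm: "sw i \<in> measurable (\<mu> i \<Otimes>\<^sub>M \<mu> i) (\<mu> i \<Otimes>\<^sub>M \<mu> i)" for i
    unfolding sw_def by (cases "i \<in> A") (auto simp: case_prod_beta')
  have swD: "distr (\<mu> i \<Otimes>\<^sub>M \<mu> i) (\<mu> i \<Otimes>\<^sub>M \<mu> i) (sw i) = \<mu> i \<Otimes>\<^sub>M \<mu> i" if "i \<in> {1..n}" for i
  proof (cases "i \<in> A")
    case True
    then have "sw i = (\<lambda>(a, b). (b, a))" by (auto simp: sw_def)
    then show ?thesis using pair_sigma_finite.distr_pair_swap[OF pair[OF that]] by simp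
  next
    case False
    then have "sw i = (\<lambda>x. x)" by (auto simp: sw_def)
    then show ?thesis by (simp add: distr_id2)
  qed
  have zipD: "distr (P \<Otimes>\<^sub>M P) Q zip = Q"
    using distr_zip_PiM[of "{1..n}" \<mu> \<mu> "\<lambda>i x. x" "\<lambda>i. \<mu> i \<Otimes>\<^sub>M \<mu> i"] \<mu>
    by (simp add: P_def Q_def zip_def distr_id2)
  have zipswD: "distr (P \<Otimes>\<^sub>M P) Q (\<lambda>(x, x'). \<lambda>i\<in>{1..n}. sw i (x i, x' i)) = Q"
  proof -
    have "distr (P \<Otimes>\<^sub>M P) Q (\<lambda>(x, x'). \<lambda>i\<in>{1..n}. sw i (x i, x' i))
        = PiM {1..n} (\<lambda>i. distr (\<mu> i \<Otimes>\<^sub>M \<mu> i) (\<mu> i \<Otimes>\<^sub>M \<mu> i) (sw i))"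
      unfolding P_def Q_def by (rule distr_zip_PiM) (use \<mu> swm in auto)
    also have "\<dots> = Q" unfolding Q_def by (intro PiM_cong refl swD)
    finally show ?thesis .
  qed
  have unzip: "unzip \<in> measurable Q (P \<Otimes>\<^sub>M P)"
    unfolding unzip_def Q_def P_def
    by (intro measurable_Pair measurable_restrict measurable_compose[OF measurable_component_singleton])
       auto
  have zipm: "zip \<in> measurable (P \<Otimes>\<^sub>M P) Q"
    unfolding zip_def Q_def P_def
    by (auto simp: case_prod_beta' intro!: measurable_restrict measurable_Pair
        measurable_compose[OF measurable_fst] measurable_compose[OF measurable_snd])
  have zipswm: "(\<lambda>(x, x'). \<lambda>i\<in>{1..n}. sw i (x i, x' i)) \<in> measurable (P \<Otimes>\<^sub>M P) Q"
    unfolding Q_def P_def case_prod_beta'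
    by (rule measurable_restrict, rule measurable_compose[OF _ swm])
       (auto intro!: measurable_Pair measurable_compose[OF measurable_fst] measurable_compose[OF measurable_snd])
  have "distr Q (P \<Otimes>\<^sub>M P) unzip = distr (P \<Otimes>\<^sub>M P) (P \<Otimes>\<^sub>M P) (unzip \<circ> zip)"
    using distr_distr[OF unzip zipm] by (simp add: zipD)
  also have "\<dots> = distr (P \<Otimes>\<^sub>M P) (P \<Otimes>\<^sub>M P) (\<lambda>p. p)"
    by (intro distr_cong) (auto simp: unzip_def zip_def P_def space_pair_measure space_PiM fun_eq_iff PiE_def extensional_def)
  finally have 1: "distr Q (P \<Otimes>\<^sub>M P) unzip = P \<Otimes>\<^sub>M P" by (simp add: distr_id2)
  have "distr Q (P \<Otimes>\<^sub>M P) unzip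
      = distr (P \<Otimes>\<^sub>M P) (P \<Otimes>\<^sub>M P) (unzip \<circ> (\<lambda>(x, x'). \<lambda>i\<in>{1..n}. sw i (x i, x' i)))"
    using distr_distr[OF unzip zipswm] unfolding zipswD .
  also have "unzip \<circ> (\<lambda>(x, x'). \<lambda>i\<in>{1..n}. sw i (x i, x' i)) = (\<lambda>(x, x'). (mix n A x x', mix n A x' x))"
    by (auto simp: unzip_def sw_def mix_def fun_eq_iff)
  finally show ?thesis using 1 by simp
qed

lemma map_vec_mix: "map_vec n f (mix n A x x') = mix n A (map_vec n f x) (map_vec n f x')"
  by (auto simp: map_vec_def mix_def)

lemma map_vec_Rn: "map_vec n f x \<in> Rn n"
  by (auto simp: map_vec_def Rn_def)

lemma map_vec_measurable:
  assumes "\<And>i. i \<in> {1..n} \<Longrightarrow> f \<in> borel_measurable (\<mu> i)"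
  shows "map_vec n f \<in> measurable (PiM {1..n} \<mu>) (PiM {1..n} (\<lambda>_. borel))"
  unfolding map_vec_def
  by (intro measurable_restrict measurable_compose[OF measurable_component_singleton] assms)

lemma gaussian_average_measurable:
  assumes F: "finite F" and V: "\<And>f. f \<in> F \<Longrightarrow> V f \<in> measurable Q (PiM {1..n} (\<lambda>_. borel))"
  shows "(\<lambda>\<omega>. gaussian_average n ((\<lambda>f. V f \<omega>) ` F)) \<in> borel_measurable Q"
proof -
  interpret G: prob_space "std_gaussian {1..n}" by (rule prob_space_std_gaussian)
  have "(\<lambda>(\<omega>, \<gamma>). SUP f\<in>F. \<Sum>i\<in>{1..n}. \<gamma> i * V f \<omega> i) \<in> borel_measurable (Q \<Otimes>\<^sub>M std_gaussian {1..n})"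
    unfolding case_prod_beta'
  proof (rule borel_measurable_cSUP)
    fix f assume f: "f \<in> F"
    have c: "(\<lambda>\<omega>. V f \<omega> i) \<in> borel_measurable Q" if "i \<in> {1..n}" for i
      using V[OF f] that by (rule measurable_compose[OF _ measurable_component_singleton])
    show "(\<lambda>p. \<Sum>i\<in>{1..n}. snd p i * V f (fst p) i) \<in> borel_measurable (Q \<Otimes>\<^sub>M std_gaussian {1..n})"
      by (intro borel_measurable_sum borel_measurable_times measurable_compose[OF measurable_fst c]
          measurable_compose[OF measurable_snd]) auto
  qed (use F in \<open>auto intro: countable_finite\<close>)
  from G.borel_measurable_lebesgue_integral[OF this] show ?thesis
    unfolding gaussian_average_eq_std_gaussian .
qed

text \<open>The law of \<open>X\<close> is the product of the \<open>\<mu> i\<close>; the expectations and probabilities of the theorem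
  are taken over this product.\<close>

locale smooth_function_of_class =
  fixes n :: nat and \<mu> :: "nat \<Rightarrow> 'x measure" and F :: "('x \<Rightarrow> real) set"
    and \<Phi> :: "(nat \<Rightarrow> real) \<Rightarrow> real" and L M :: real
  assumes n: "n \<ge> 1" and \<mu>: "\<And>i. i \<in> {1..n} \<Longrightarrow> prob_space (\<mu> i)"
    and F: "finite F" "F \<noteq> {}"
    and F_meas: "\<And>f i. f \<in> F \<Longrightarrow> i \<in> {1..n} \<Longrightarrow> f \<in> borel_measurable (\<mu> i)"
    and F_range: "\<And>f i x. f \<in> F \<Longrightarrow> i \<in> {1..n} \<Longrightarrow> x \<in> space (\<mu> i) \<Longrightarrow> f x \<in> {0..1}"
    and td: "twice_differentiable_Rn n \<Phi>" and L: "first_order_bound n \<Phi> L"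
    and M: "mixed_second_order_bound n \<Phi> M"
begin

abbreviation P :: "(nat \<Rightarrow> 'x) measure" where "P \<equiv> PiM {1..n} \<mu>"

sublocale P: prob_space P
  by (intro prob_space_PiM \<mu>)

sublocale PP: pair_prob_space P P ..

lemma L_nonneg: "0 \<le> L"
  by (rule first_order_bound_nonneg[OF L n])

lemma map_vec_range: "f \<in> F \<Longrightarrow> x \<in> space P \<Longrightarrow> i \<in> {1..n} \<Longrightarrow> map_vec n f x i \<in> {0..1}"
  using F_range[of f i "x i"] by (auto simp: map_vec_def space_PiM PiE_iff)

lemma \<Phi>_map_vec_measurable:
  "f \<in> F \<Longrightarrow> (\<lambda>x. \<Phi> (map_vec n f x)) \<in> borel_measurable P"
  by (rule measurable_compose[OF map_vec_measurable Lipschitz_borel_measurable])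
     (use F_meas Lipschitz_Rn[OF td L] in auto)

lemma \<Phi>_map_vec_diff_le:
  assumes "f \<in> F" "x \<in> space P" "x' \<in> space P"
  shows "\<bar>\<Phi> (map_vec n f x') - \<Phi> (map_vec n f x)\<bar> \<le> L * n"
proof -
  have "\<bar>\<Phi> (map_vec n f x') - \<Phi> (map_vec n f x)\<bar> \<le> L * (\<Sum>i=1..n. \<bar>map_vec n f x' i - map_vec n f x i\<bar>)"
    by (rule Lipschitz_Rn[OF td L]) (auto intro: map_vec_Rn)
  also have "\<dots> \<le> L * (\<Sum>i=1..n. 1)"
  proof (intro mult_left_mono sum_mono L_nonneg)
    fix i assume "i \<in> {1..n}"
    from map_vec_range[OF assms(1,2) this] map_vec_range[OF assms(1,3) this]
    show "\<bar>map_vec n f x' i - map_vec n f x i\<bar> \<le> 1" by auto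
  qed
  finally show ?thesis by simp
qed

lemma integrable_\<Phi>_map_vec:
  assumes f: "f \<in> F"
  shows "integrable P (\<lambda>x. \<Phi> (map_vec n f x))"
proof -
  obtain x0 where x0: "x0 \<in> space P" using P.not_empty by blast
  show ?thesis
  proof (rule P.integrable_const_bound)
    show "AE x in P. norm (\<Phi> (map_vec n f x)) \<le> \<bar>\<Phi> (map_vec n f x0)\<bar> + L * n"
      using \<Phi>_map_vec_diff_le[OF f x0] by (intro AE_I2) force
  qed (rule \<Phi>_map_vec_measurable[OF f])
qed

definition deviation :: "(nat \<Rightarrow> 'x) \<Rightarrow> real" where
  "deviation x = (SUP f\<in>F. (\<integral>x'. \<Phi> (map_vec n f x') \<partial>P) - \<Phi> (map_vec n f x))"

definition average :: "(nat \<Rightarrow> 'x) \<Rightarrow> real" where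
  "average x = gaussian_average n (class_image n F x)"

lemma average_eq:
  "average x = (\<integral>\<gamma>. (SUP f\<in>F. \<Sum>i\<in>{1..n}. \<gamma> i * map_vec n f x i) \<partial>std_gaussian {1..n})"
  unfolding average_def class_image_def by (rule gaussian_average_eq_std_gaussian)

lemma average_nonneg: "0 \<le> average x"
  unfolding average_def class_image_def by (rule gaussian_average_nonneg[OF F])

lemma average_measurable: "average \<in> borel_measurable P"
  unfolding average_def[abs_def] class_image_def
  by (rule gaussian_average_measurable[OF F(1) map_vec_measurable[OF F_meas]])

text \<open>Since the values are in \<open>[0, 1]\<close>, the expectation of \<open>\<Sum>\<^sub>i \<bar>\<gamma>\<^sub>i\<bar>\<close> bounds all these Gaussian
  averages.\<close>

lemma integrable_average: "integrable P average"
proof (rule P.integrable_const_bound[OF _ average_measurable])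
  let ?b = "\<integral>\<gamma>. (\<Sum>i\<in>{1..n}. \<bar>\<gamma> i\<bar>) \<partial>std_gaussian {1..n}"
  have "average x \<le> ?b" if x: "x \<in> space P" for x
    unfolding average_eq
  proof (rule integral_mono)
    show "integrable (std_gaussian {1..n}) (\<lambda>\<gamma>. SUP f\<in>F. \<Sum>i\<in>{1..n}. \<gamma> i * map_vec n f x i)"
      using integrable_gaussian_max[OF _ F, of "{1..n}" "\<lambda>_. 0" "\<lambda>f. map_vec n f x"] by simp
    show "integrable (std_gaussian {1..n}) (\<lambda>\<gamma>. \<Sum>i\<in>{1..n}. \<bar>\<gamma> i\<bar>)"
      by (intro Bochner_Integration.integrable_sum integrable_abs integrable_std_gaussian_component)
    fix \<gamma> :: "nat \<Rightarrow> real"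
    show "(SUP f\<in>F. \<Sum>i\<in>{1..n}. \<gamma> i * map_vec n f x i) \<le> (\<Sum>i\<in>{1..n}. \<bar>\<gamma> i\<bar>)"
    proof (rule cSUP_least[OF F(2)], rule sum_mono)
      fix f i assume "f \<in> F" "i \<in> {1..n}"
      from map_vec_range[OF this(1) x this(2)]
      have "\<bar>\<gamma> i * map_vec n f x i\<bar> \<le> \<bar>\<gamma> i\<bar> * 1"
        unfolding abs_mult by (intro mult_left_mono) auto
      then show "\<gamma> i * map_vec n f x i \<le> \<bar>\<gamma> i\<bar>" by simp
    qed
  qed
  then show "AE x in P. norm (average x) \<le> ?b"
    using average_nonneg by (intro AE_I2) simp
qed

lemma integrable_deviation: "integrable P deviation"
  unfolding deviation_def
  by (rule integrable_SUP_finite[OF F]) (intro Bochner_Integration.integrable_diff integrable_\<Phi>_map_vec P.integrable_const)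

text \<open>Moving the expectation over \<open>x'\<close> out of the supremum leaves the supremum \<open>H\<close> of \<open>\<Phi>(f(x')) -
  \<Phi>(f(x))\<close>. Its expectation does not change if coordinates are exchanged, so it equals the
  average over all exchanges, and this average is bounded for each \<open>(x, x')\<close> separately. The
  factor \<open>2\<close> arises because \<open>x\<close> and \<open>x'\<close> contribute the same expected Gaussian average.\<close>

lemma expectation_deviation_le:
  "(\<integral>x. deviation x \<partial>P) \<le> 2 * sqrt (3 * pi / 2) * (M + L) * (\<integral>x. average x \<partial>P)"
proof -
  define H where "H p = (SUP f\<in>F. \<Phi> (map_vec n f (snd p)) - \<Phi> (map_vec n f (fst p)))" for p
  define sw where "sw A = (\<lambda>(x, x'). (mix n A x x', mix n A x' x) :: (nat \<Rightarrow> 'x) \<times> (nat \<Rightarrow> 'x))" for A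
  have iH: "integrable (P \<Otimes>\<^sub>M P) H"
    unfolding H_def
  proof (rule integrable_SUP_finite[OF F])
    fix f assume f: "f \<in> F"
    show "integrable (P \<Otimes>\<^sub>M P) (\<lambda>p. \<Phi> (map_vec n f (snd p)) - \<Phi> (map_vec n f (fst p)))"
    proof (rule PP.P.integrable_const_bound)
      show "AE p in P \<Otimes>\<^sub>M P. norm (\<Phi> (map_vec n f (snd p)) - \<Phi> (map_vec n f (fst p))) \<le> L * n"
        using \<Phi>_map_vec_diff_le[OF f] by (intro AE_I2) (auto simp: space_pair_measure)
    qed (intro borel_measurable_diff measurable_compose[OF measurable_snd \<Phi>_map_vec_measurable[OF f]]
        measurable_compose[OF measurable_fst \<Phi>_map_vec_measurable[OF f]])
  qed
  have swD: "distr (P \<Otimes>\<^sub>M P) (P \<Otimes>\<^sub>M P) (sw A) = P \<Otimes>\<^sub>M P" for A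
    unfolding sw_def by (rule distr_swap_coordinates) (rule \<mu>)
  have swm: "sw A \<in> measurable (P \<Otimes>\<^sub>M P) (P \<Otimes>\<^sub>M P)" for A
  proof -
    have "(\<lambda>p. mix n A (fst p) (snd p)) \<in> measurable (P \<Otimes>\<^sub>M P) P"
      "(\<lambda>p. mix n A (snd p) (fst p)) \<in> measurable (P \<Otimes>\<^sub>M P) P"
      unfolding mix_def by (rule measurable_restrict; simp; intro conjI impI;
          (rule measurable_compose[OF measurable_fst measurable_component_singleton]
            measurable_compose[OF measurable_snd measurable_component_singleton]; simp))+
    then show ?thesis unfolding sw_def case_prod_beta' by (rule measurable_Pair)
  qed
  have isw: "integrable (P \<Otimes>\<^sub>M P) (\<lambda>p. H (sw A p))" for A
    using integrable_distr_eq[OF swm borel_measurable_integrable[OF iH], of A] iH unfolding swD by simp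
  have esw: "(\<integral>p. H (sw A p) \<partial>(P \<Otimes>\<^sub>M P)) = (\<integral>p. H p \<partial>(P \<Otimes>\<^sub>M P))" for A
    using integral_distr[OF swm borel_measurable_integrable[OF iH], of A] unfolding swD by simp
  have af: "integrable (P \<Otimes>\<^sub>M P) (\<lambda>p. average (fst p))"
      "(\<integral>p. average (fst p) \<partial>(P \<Otimes>\<^sub>M P)) = (\<integral>x. average x \<partial>P)"
    using integrable_distr_eq[OF measurable_fst average_measurable, of P]
      integral_distr[OF measurable_fst average_measurable, of P] integrable_average
    unfolding P.distr_pair_fst by simp_all
  have as: "integrable (P \<Otimes>\<^sub>M P) (\<lambda>p. average (snd p))"
      "(\<integral>p. average (snd p) \<partial>(P \<Otimes>\<^sub>M P)) = (\<integral>x. average x \<partial>P)"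
    using integrable_distr_eq[OF measurable_snd average_measurable, of P]
      integral_distr[OF measurable_snd average_measurable, of P] integrable_average
    unfolding PP.distr_pair_snd by simp_all
  have "(\<integral>x. deviation x \<partial>P) \<le> (\<integral>x. (\<integral>x'. H (x, x') \<partial>P) \<partial>P)"
  proof (rule integral_mono_AE)
    show "integrable P deviation" by (rule integrable_deviation)
    show "integrable P (\<lambda>x. \<integral>x'. H (x, x') \<partial>P)" by (rule PP.integrable_fst'[OF iH])
    have iH2: "AE x in P. integrable P (\<lambda>x'. H (x, x'))" by (rule PP.AE_integrable_fst'[OF iH])
    then show "AE x in P. deviation x \<le> (\<integral>x'. H (x, x') \<partial>P)"
    proof (rule AE_mp, intro AE_I2 impI)
      fix x assume ix: "integrable P (\<lambda>x'. H (x, x'))"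
      show "deviation x \<le> (\<integral>x'. H (x, x') \<partial>P)"
        unfolding deviation_def
      proof (rule cSUP_least[OF F(2)])
        fix f assume f: "f \<in> F"
        have "(\<integral>x'. \<Phi> (map_vec n f x') \<partial>P) - \<Phi> (map_vec n f x) = (\<integral>x'. \<Phi> (map_vec n f x') - \<Phi> (map_vec n f x) \<partial>P)"
          using Bochner_Integration.integral_diff[OF integrable_\<Phi>_map_vec[OF f] P.integrable_const[of "\<Phi> (map_vec n f x)"]]
            P.prob_space by simp
        also have "\<dots> \<le> (\<integral>x'. H (x, x') \<partial>P)"
        proof (rule integral_mono[OF _ ix])
          show "integrable P (\<lambda>x'. \<Phi> (map_vec n f x') - \<Phi> (map_vec n f x))"
            by (intro Bochner_Integration.integrable_diff integrable_\<Phi>_map_vec f P.integrable_const)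
          show "\<Phi> (map_vec n f x') - \<Phi> (map_vec n f x) \<le> H (x, x')" for x'
            unfolding H_def
            using SUP_finite_upper[OF F(1) f, of "\<lambda>f. \<Phi> (map_vec n f x') - \<Phi> (map_vec n f x)"] by simp
        qed
        finally show "(\<integral>x'. \<Phi> (map_vec n f x') \<partial>P) - \<Phi> (map_vec n f x) \<le> (\<integral>x'. H (x, x') \<partial>P)" .
      qed
    qed
  qed
  also have "\<dots> = (\<integral>p. H p \<partial>(P \<Otimes>\<^sub>M P))" by (rule PP.integral_fst'[OF iH])
  also have "\<dots> = (\<Sum>A\<in>Pow {1..n}. \<integral>p. H (sw ({1..n} - A) p) \<partial>(P \<Otimes>\<^sub>M P)) / 2 ^ n"
    unfolding esw by (simp add: card_Pow)
  also have "\<dots> = (\<integral>p. (\<Sum>A\<in>Pow {1..n}. H (sw ({1..n} - A) p)) / 2 ^ n \<partial>(P \<Otimes>\<^sub>M P))"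
    using isw by simp
  also have "\<dots> \<le> (\<integral>p. sqrt (3 * pi / 2) * (L + M) * (average (fst p) + average (snd p)) \<partial>(P \<Otimes>\<^sub>M P))"
  proof (rule integral_mono)
    show "integrable (P \<Otimes>\<^sub>M P) (\<lambda>p. (\<Sum>A\<in>Pow {1..n}. H (sw ({1..n} - A) p)) / 2 ^ n)"
      using isw by simp
    show "integrable (P \<Otimes>\<^sub>M P) (\<lambda>p. sqrt (3 * pi / 2) * (L + M) * (average (fst p) + average (snd p)))"
      by (intro integrable_mult_right Bochner_Integration.integrable_add af as)
    fix p assume p: "p \<in> space (P \<Otimes>\<^sub>M P)"
    then obtain x x' where xx: "p = (x, x')" "x \<in> space P" "x' \<in> space P" by (auto simp: space_pair_measure)
    \<comment> \<open>Exchanging the coordinates outside \<open>A\<close> turns \<open>x'\<close> into the mixture that has \<open>x'\<close> on \<open>A\<close> and \<open>x\<close> elsewhere.\<close>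
    have "H (sw ({1..n} - A) p) = (SUP f\<in>F. \<Phi> (mix n A (map_vec n f x) (map_vec n f x'))
        - \<Phi> (mix n ({1..n} - A) (map_vec n f x) (map_vec n f x')))" for A
    proof -
      have "mix n ({1..n} - A) x' x = mix n A x x'" by (auto simp: mix_def fun_eq_iff)
      then show ?thesis by (simp add: H_def sw_def xx(1) map_vec_mix)
    qed
    then have "(\<Sum>A\<in>Pow {1..n}. H (sw ({1..n} - A) p)) / 2 ^ n
      = (\<Sum>A\<in>Pow {1..n}. SUP f\<in>F. \<Phi> (mix n A (map_vec n f x) (map_vec n f x'))
        - \<Phi> (mix n ({1..n} - A) (map_vec n f x) (map_vec n f x'))) / 2 ^ n" by simp
    also have "\<dots> \<le> sqrt (3 * pi / 2) * (L + M) *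
       (gaussian_average n ((\<lambda>f. map_vec n f x) ` F) + gaussian_average n ((\<lambda>f. map_vec n f x') ` F))"
      by (rule hypercube_symmetrized_bound[OF td L M n F])
         (use map_vec_range xx in auto)
    finally show "(\<Sum>A\<in>Pow {1..n}. H (sw ({1..n} - A) p)) / 2 ^ n
       \<le> sqrt (3 * pi / 2) * (L + M) * (average (fst p) + average (snd p))"
      unfolding average_def class_image_def xx(1) by simp
  qed
  also have "\<dots> = 2 * sqrt (3 * pi / 2) * (M + L) * (\<integral>x. average x \<partial>P)"
    using af as by (simp add: add.commute)
  finally show ?thesis .
qed

end

section \<open>The bounded difference inequality\<close>

text \<open>Hoeffding's lemma for a variable whose range has diameter at most \<open>c\<close>: it lies in an interval
  of length \<open>c\<close> that starts at its infimum.\<close>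

lemma Hoeffding_oscillation:
  fixes f :: "'a \<Rightarrow> real"
  assumes "prob_space N" and f: "f \<in> borel_measurable N"
    and osc: "\<And>y y'. y \<in> space N \<Longrightarrow> y' \<in> space N \<Longrightarrow> \<bar>f y - f y'\<bar> \<le> c" and s: "s > 0"
  shows "(\<integral>y. exp (s * f y) \<partial>N) \<le> exp (s * (\<integral>y. f y \<partial>N) + s\<^sup>2 * c\<^sup>2 / 8)"
proof -
  interpret N: prob_space N by fact
  obtain y0 where y0: "y0 \<in> space N" using N.not_empty by blast
  define a where "a = (INF y\<in>space N. f y)"
  have bdd: "bdd_below (f ` space N)"
    by (rule bdd_belowI[of _ "f y0 - c"]) (use osc[OF y0] in \<open>fastforce simp: abs_le_iff\<close>)
  have ge: "a \<le> f y" if "y \<in> space N" for y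
    unfolding a_def using bdd that by (rule cINF_lower)
  have le: "f y \<le> a + c" if y: "y \<in> space N" for y
  proof -
    have "f y - c \<le> a" unfolding a_def
      by (rule cINF_greatest) (use y0 osc[OF y] in \<open>fastforce simp: abs_le_iff\<close>)+
    then show ?thesis by simp
  qed
  interpret B: interval_bounded_random_variable N f a "a + c"
    by unfold_locales (use f ge le in auto)
  have int: "integrable N (\<lambda>y. exp (s * (f y - N.expectation f)))"
  proof (rule N.integrable_const_bound)
    show "AE y in N. norm (exp (s * (f y - N.expectation f))) \<le> exp (s * (a + c - N.expectation f))"
      using le s by (intro AE_I2) simp
  qed (use f in measurable)
  have "ennreal (\<integral>y. exp (s * (f y - N.expectation f)) \<partial>N) = (\<integral>\<^sup>+y. exp (s * (f y - N.expectation f)) \<partial>N)"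
    by (rule nn_integral_eq_integral[symmetric, OF int]) simp
  also have "\<dots> \<le> ennreal (exp (s\<^sup>2 * (a + c - a)\<^sup>2 / 8))"
    by (rule B.Hoeffdings_lemma_nn_integral[OF s])
  finally have le': "(\<integral>y. exp (s * (f y - N.expectation f)) \<partial>N) \<le> exp (s\<^sup>2 * c\<^sup>2 / 8)" by simp
  have "(\<integral>y. exp (s * f y) \<partial>N) = (\<integral>y. exp (s * N.expectation f) * exp (s * (f y - N.expectation f)) \<partial>N)"
    by (simp flip: exp_add add: algebra_simps)
  also have "\<dots> = exp (s * N.expectation f) * (\<integral>y. exp (s * (f y - N.expectation f)) \<partial>N)" by simp
  also have "\<dots> \<le> exp (s * N.expectation f) * exp (s\<^sup>2 * c\<^sup>2 / 8)" using le' by (intro mult_left_mono) auto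
  finally show ?thesis by (simp add: exp_add)
qed

text \<open>Integrating out one coordinate \<open>i\<close> by Hoeffding's lemma replaces \<open>g\<close> by its partial mean \<open>g'\<close>
  and contributes the factor \<open>exp (s\<^sup>2 (c i)\<^sup>2 / 8)\<close>; partial means satisfy the same bounds on
  their differences, so induction over the coordinates applies.\<close>

lemma bounded_differences_mgf:
  fixes \<mu> :: "'i \<Rightarrow> 'a measure" and g :: "('i \<Rightarrow> 'a) \<Rightarrow> real"
  assumes "finite I" and \<mu>: "\<And>i. prob_space (\<mu> i)" and s: "s > 0"
    and "g \<in> borel_measurable (PiM I \<mu>)" and "\<And>x. x \<in> space (PiM I \<mu>) \<Longrightarrow> \<bar>g x\<bar> \<le> B"
    and "\<And>i x a. i \<in> I \<Longrightarrow> x \<in> space (PiM I \<mu>) \<Longrightarrow> a \<in> space (\<mu> i) \<Longrightarrow> \<bar>g (x(i := a)) - g x\<bar> \<le> c i"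
  shows "(\<integral>x. exp (s * g x) \<partial>PiM I \<mu>) \<le> exp (s * (\<integral>x. g x \<partial>PiM I \<mu>) + s\<^sup>2 * (\<Sum>i\<in>I. (c i)\<^sup>2) / 8)"
  using assms(1,4-6)
proof (induction I arbitrary: g rule: finite_induct)
  case empty
  then show ?case by (simp add: PiM_empty lebesgue_integral_count_space_finite)
next
  case (insert i I)
  interpret product_sigma_finite \<mu> by (simp add: product_sigma_finite_def prob_space_imp_sigma_finite \<mu>)
  interpret Mi: prob_space "\<mu> i" by (rule \<mu>)
  interpret PI: prob_space "PiM I \<mu>" by (intro prob_space_PiM \<mu>)
  interpret PII: prob_space "PiM (insert i I) \<mu>" by (intro prob_space_PiM \<mu>)
  have gm: "g \<in> borel_measurable (PiM (insert i I) \<mu>)" by (rule insert.prems(1))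
  have upd: "x(i := y) \<in> space (PiM (insert i I) \<mu>)" if "x \<in> space (PiM I \<mu>)" "y \<in> space (\<mu> i)" for x y
    using that by (auto simp: space_PiM PiE_def extensional_def)
  have gm2: "(\<lambda>(x, y). g (x(i := y))) \<in> borel_measurable (PiM I \<mu> \<Otimes>\<^sub>M \<mu> i)"
    using measurable_compose[OF measurable_add_dim gm] by (simp add: case_prod_beta')
  have sec: "(\<lambda>y. g (x(i := y))) \<in> borel_measurable (\<mu> i)" if "x \<in> space (PiM I \<mu>)" for x
    using measurable_compose[OF measurable_Pair1'[OF that] gm2] by simp
  define g' where "g' x = (\<integral>y. g (x(i := y)) \<partial>\<mu> i)" for x
  have isec: "integrable (\<mu> i) (\<lambda>y. g (x(i := y)))" if x: "x \<in> space (PiM I \<mu>)" for x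
    by (rule Mi.integrable_const_bound[OF _ sec[OF x], where B = B])
       (use insert.prems(2) upd[OF x] in \<open>auto intro!: AE_I2\<close>)
  have g'm: "g' \<in> borel_measurable (PiM I \<mu>)"
    unfolding g'_def by (rule M.borel_measurable_lebesgue_integral[OF gm2])
  have g'B: "\<bar>g' x\<bar> \<le> B" if x: "x \<in> space (PiM I \<mu>)" for x
  proof -
    have "\<bar>g' x\<bar> \<le> (\<integral>y. \<bar>g (x(i := y))\<bar> \<partial>\<mu> i)" unfolding g'_def by (rule integral_abs_bound)
    also have "\<dots> \<le> (\<integral>y. B \<partial>\<mu> i)"
      using insert.prems(2) upd[OF x] isec[OF x] by (intro integral_mono) auto
    finally show ?thesis by (simp add: Mi.prob_space)
  qed
  have gint: "integrable (PiM (insert i I) \<mu>) g"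
    by (rule PII.integrable_const_bound[OF _ gm, where B = B]) (use insert.prems(2) in \<open>auto intro!: AE_I2\<close>)
  have eint: "integrable (PiM (insert i I) \<mu>) (\<lambda>x. exp (s * g x))"
  proof (rule PII.integrable_const_bound[where B = "exp (s * B)"])
    show "AE x in PiM (insert i I) \<mu>. norm (exp (s * g x)) \<le> exp (s * B)"
      using insert.prems(2) s by (intro AE_I2) (force simp: abs_le_iff)
  qed (use gm in measurable)
  have g'int: "integrable (PiM I \<mu>) g'"
    by (rule PI.integrable_const_bound[OF _ g'm, where B = B]) (use g'B in \<open>auto intro!: AE_I2\<close>)
  have e'int: "integrable (PiM I \<mu>) (\<lambda>x. exp (s * g' x + s\<^sup>2 * (c i)\<^sup>2 / 8))"
  proof (rule PI.integrable_const_bound[where B = "exp (s * B + s\<^sup>2 * (c i)\<^sup>2 / 8)"])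
    show "AE x in PiM I \<mu>. norm (exp (s * g' x + s\<^sup>2 * (c i)\<^sup>2 / 8)) \<le> exp (s * B + s\<^sup>2 * (c i)\<^sup>2 / 8)"
      using g'B s by (intro AE_I2) (force simp: abs_le_iff)
  qed (use g'm in measurable)
  have "(\<integral>x. exp (s * g x) \<partial>PiM (insert i I) \<mu>) = (\<integral>x. (\<integral>y. exp (s * g (x(i := y))) \<partial>\<mu> i) \<partial>PiM I \<mu>)"
    by (rule product_integral_insert[OF insert.hyps eint])
  also have "\<dots> \<le> (\<integral>x. exp (s * g' x + s\<^sup>2 * (c i)\<^sup>2 / 8) \<partial>PiM I \<mu>)"
  proof (rule integral_mono')
    fix x assume x: "x \<in> space (PiM I \<mu>)"
    show "(\<integral>y. exp (s * g (x(i := y))) \<partial>\<mu> i) \<le> exp (s * g' x + s\<^sup>2 * (c i)\<^sup>2 / 8)"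
      unfolding g'_def
    proof (rule Hoeffding_oscillation[OF \<mu> sec[OF x] _ s])
      fix y y' assume y: "y \<in> space (\<mu> i)" "y' \<in> space (\<mu> i)"
      have "\<bar>g ((x(i := y'))(i := y)) - g (x(i := y'))\<bar> \<le> c i"
        by (rule insert.prems(3)[OF insertI1 upd[OF x y(2)] y(1)])
      then show "\<bar>g (x(i := y)) - g (x(i := y'))\<bar> \<le> c i" by simp
    qed
  qed (use e'int in auto)
  also have "\<dots> = exp (s\<^sup>2 * (c i)\<^sup>2 / 8) * (\<integral>x. exp (s * g' x) \<partial>PiM I \<mu>)"
    by (simp add: exp_add mult.commute)
  also have "\<dots> \<le> exp (s\<^sup>2 * (c i)\<^sup>2 / 8) * exp (s * (\<integral>x. g' x \<partial>PiM I \<mu>) + s\<^sup>2 * (\<Sum>i\<in>I. (c i)\<^sup>2) / 8)"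
  proof (intro mult_left_mono insert.IH g'm g'B)
    fix j x a assume j: "j \<in> I" and x: "x \<in> space (PiM I \<mu>)" and a: "a \<in> space (\<mu> j)"
    have ji: "j \<noteq> i" using j insert.hyps(2) by auto
    have xa: "x(j := a) \<in> space (PiM I \<mu>)" using x a j by (auto simp: space_PiM PiE_def extensional_def)
    have "\<bar>g' (x(j := a)) - g' x\<bar> = \<bar>\<integral>y. g ((x(j := a))(i := y)) - g (x(i := y)) \<partial>\<mu> i\<bar>"
      unfolding g'_def using isec[OF xa] isec[OF x] by simp
    also have "\<dots> \<le> (\<integral>y. \<bar>g ((x(j := a))(i := y)) - g (x(i := y))\<bar> \<partial>\<mu> i)" by (rule integral_abs_bound)
    also have "\<dots> \<le> (\<integral>y. c j \<partial>\<mu> i)"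
    proof (rule integral_mono)
      fix y assume y: "y \<in> space (\<mu> i)"
      have "\<bar>g ((x(i := y))(j := a)) - g (x(i := y))\<bar> \<le> c j"
        by (rule insert.prems(3)[OF insertI2[OF j] upd[OF x y] a])
      then show "\<bar>g ((x(j := a))(i := y)) - g (x(i := y))\<bar> \<le> c j"
        using ji by (simp add: fun_upd_twist)
    qed (use isec[OF xa] isec[OF x] in auto)
    finally show "\<bar>g' (x(j := a)) - g' x\<bar> \<le> c j" by (simp add: Mi.prob_space)
  qed auto
  also have "(\<integral>x. g' x \<partial>PiM I \<mu>) = (\<integral>x. g x \<partial>PiM (insert i I) \<mu>)"
    unfolding g'_def by (rule product_integral_insert[OF insert.hyps gint, symmetric])
  also have "exp (s\<^sup>2 * (c i)\<^sup>2 / 8) * exp (s * (\<integral>x. g x \<partial>PiM (insert i I) \<mu>) + s\<^sup>2 * (\<Sum>i\<in>I. (c i)\<^sup>2) / 8)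
      = exp (s * (\<integral>x. g x \<partial>PiM (insert i I) \<mu>) + s\<^sup>2 * (\<Sum>i\<in>insert i I. (c i)\<^sup>2) / 8)"
    using insert.hyps by (simp flip: exp_add add: algebra_simps add_divide_distrib)
  finally show ?case .
qed

text \<open>Markov's inequality for \<open>exp (s g)\<close> with the optimal \<open>s = 4 t / \<Sum>\<^sub>i (c i)\<^sup>2\<close>.\<close>

lemma bounded_differences_tail:
  fixes \<mu> :: "'i \<Rightarrow> 'a measure" and g :: "('i \<Rightarrow> 'a) \<Rightarrow> real"
  assumes I: "finite I" and \<mu>: "\<And>i. i \<in> I \<Longrightarrow> prob_space (\<mu> i)"
    and gm: "g \<in> borel_measurable (PiM I \<mu>)" and gB: "\<And>x. x \<in> space (PiM I \<mu>) \<Longrightarrow> \<bar>g x\<bar> \<le> B"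
    and diff: "\<And>i x a. i \<in> I \<Longrightarrow> x \<in> space (PiM I \<mu>) \<Longrightarrow> a \<in> space (\<mu> i) \<Longrightarrow> \<bar>g (x(i := a)) - g x\<bar> \<le> c i"
    and pos: "(\<Sum>i\<in>I. (c i)\<^sup>2) > 0" and t: "t > 0"
  shows "measure (PiM I \<mu>) {x\<in>space (PiM I \<mu>). g x \<ge> (\<integral>x. g x \<partial>PiM I \<mu>) + t}
    \<le> exp (- 2 * t\<^sup>2 / (\<Sum>i\<in>I. (c i)\<^sup>2))"
proof -
  \<comment> \<open>Factors outside \<open>I\<close> do not affect the product; any probability measure may be put there.\<close>
  define \<mu>' where "\<mu>' i = (if i \<in> I then \<mu> i else return (count_space UNIV) undefined)" for i
  have eq: "PiM I \<mu> = PiM I \<mu>'" by (auto intro!: PiM_cong simp: \<mu>'_def)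
  have \<mu>': "prob_space (\<mu>' i)" for i using \<mu> by (auto simp: \<mu>'_def intro!: prob_space_return)
  interpret prob_space "PiM I \<mu>" by (intro prob_space_PiM \<mu>)
  define S where "S = (\<Sum>i\<in>I. (c i)\<^sup>2)"
  define m where "m = (\<integral>x. g x \<partial>PiM I \<mu>)"
  define s where "s = 4 * t / S"
  have s: "s > 0" using t pos by (simp add: s_def S_def)
  have mgf: "(\<integral>x. exp (s * g x) \<partial>PiM I \<mu>) \<le> exp (s * m + s\<^sup>2 * S / 8)"
    unfolding m_def S_def eq
  proof (rule bounded_differences_mgf[OF I \<mu>' s])
    show "g \<in> borel_measurable (PiM I \<mu>')" "\<And>x. x \<in> space (PiM I \<mu>') \<Longrightarrow> \<bar>g x\<bar> \<le> B"
      using gm gB unfolding eq by blast+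
    fix i x a assume i: "i \<in> I" and x: "x \<in> space (PiM I \<mu>')" and "a \<in> space (\<mu>' i)"
    then have "a \<in> space (\<mu> i)" by (simp add: \<mu>'_def)
    then show "\<bar>g (x(i := a)) - g x\<bar> \<le> c i" using diff[OF i] x unfolding eq by blast
  qed
  have eint: "integrable (PiM I \<mu>) (\<lambda>x. exp (s * g x))"
  proof (rule integrable_const_bound[where B = "exp (s * B)"])
    show "AE x in PiM I \<mu>. norm (exp (s * g x)) \<le> exp (s * B)"
      using gB s by (intro AE_I2) (force simp: abs_le_iff)
  qed (use gm in measurable)
  have "{x\<in>space (PiM I \<mu>). g x \<ge> m + t} = {x\<in>space (PiM I \<mu>). exp (s * g x) \<ge> exp (s * (m + t))}"
    using s by auto
  then have "measure (PiM I \<mu>) {x\<in>space (PiM I \<mu>). g x \<ge> m + t}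
     \<le> (\<integral>x. exp (s * g x) \<partial>PiM I \<mu>) / exp (s * (m + t))"
    using integral_Markov_inequality_measure[OF eint, of "space (PiM I \<mu>)" "exp (s * (m + t))"] by simp
  also have "\<dots> \<le> exp (s * m + s\<^sup>2 * S / 8) / exp (s * (m + t))"
    using mgf by (intro divide_right_mono) auto
  also have "\<dots> = exp (s\<^sup>2 * S / 8 - s * t)" by (simp flip: exp_diff add: algebra_simps)
  also have "s\<^sup>2 * S / 8 - s * t = - 2 * t\<^sup>2 / S"
    using pos unfolding s_def S_def[symmetric] by (simp add: power2_eq_square field_simps)
  finally show ?thesis unfolding m_def S_def .
qed

section \<open>Deviation bounds on a product space\<close>

text \<open>The two conclusions of the theorem, as a statement about the random vectors \<open>V f\<close>, which stand
  for \<open>f(X)\<close>, and the numbers \<open>e f\<close>, which stand for \<open>E \<Phi>(f(X'))\<close>. In this form they depend only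
  on the joint law of the \<open>V f\<close>, and can be moved along measurable maps and reindexings.\<close>

definition deviation_bounds ::
  "'w measure \<Rightarrow> 'f set \<Rightarrow> ('f \<Rightarrow> 'w \<Rightarrow> nat \<Rightarrow> real) \<Rightarrow> ('f \<Rightarrow> real) \<Rightarrow>
   nat \<Rightarrow> ((nat \<Rightarrow> real) \<Rightarrow> real) \<Rightarrow> real \<Rightarrow> real \<Rightarrow> real \<Rightarrow> bool" where
  "deviation_bounds P F V e n \<Phi> L M c \<longleftrightarrow>
     (\<integral>\<omega>. (SUP f\<in>F. e f - \<Phi> (V f \<omega>)) \<partial>P)
       \<le> c * (M + L) * (\<integral>\<omega>. gaussian_average n ((\<lambda>f. V f \<omega>) ` F) \<partial>P) \<and>
     (\<forall>\<delta>>0. measure P {\<omega>\<in>space P. \<forall>f\<in>F. e f \<le> \<Phi> (V f \<omega>)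
         + c * (L + M) * (\<integral>\<omega>'. gaussian_average n ((\<lambda>f. V f \<omega>') ` F) \<partial>P)
         + L * sqrt (real n * ln (1 / \<delta>) / 2)} \<ge> 1 - \<delta>)"

lemma deviation_bounds_image:
  "deviation_bounds P (h ` F) V e n \<Phi> L M c \<longleftrightarrow> deviation_bounds P F (\<lambda>f. V (h f)) (\<lambda>f. e (h f)) n \<Phi> L M c"
  unfolding deviation_bounds_def by (simp add: image_image)

lemma deviation_bounds_cong:
  assumes "\<And>f \<omega>. f \<in> F \<Longrightarrow> \<omega> \<in> space P \<Longrightarrow> V f \<omega> = V' f \<omega>" and "\<And>f. f \<in> F \<Longrightarrow> e f = e' f"
  shows "deviation_bounds P F V e n \<Phi> L M c \<longleftrightarrow> deviation_bounds P F V' e' n \<Phi> L M c"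
proof -
  have 1: "(\<integral>\<omega>. (SUP f\<in>F. e f - \<Phi> (V f \<omega>)) \<partial>P) = (\<integral>\<omega>. (SUP f\<in>F. e' f - \<Phi> (V' f \<omega>)) \<partial>P)"
    using assms by (intro Bochner_Integration.integral_cong refl SUP_cong) auto
  have 2: "(\<integral>\<omega>. gaussian_average n ((\<lambda>f. V f \<omega>) ` F) \<partial>P) = (\<integral>\<omega>. gaussian_average n ((\<lambda>f. V' f \<omega>) ` F) \<partial>P)"
    using assms by (intro Bochner_Integration.integral_cong refl arg_cong[of _ _ "gaussian_average n"] image_cong) auto
  show ?thesis unfolding deviation_bounds_def 1 2
    by (intro conj_cong refl all_cong arg_cong[of _ _ "\<lambda>A. _ \<le> measure P A"] Collect_cong) (auto simp: assms)
qed

lemma deviation_bounds_distr: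
  assumes F: "finite F" and q: "q \<in> measurable P Q"
    and V: "\<And>f. f \<in> F \<Longrightarrow> V f \<in> measurable Q (PiM {1..n} (\<lambda>_. borel))"
    and \<Phi>: "\<Phi> \<in> borel_measurable (PiM {1..n} (\<lambda>_. borel))"
  shows "deviation_bounds (distr P Q q) F V e n \<Phi> L M c \<longleftrightarrow> deviation_bounds P F (\<lambda>f \<omega>. V f (q \<omega>)) e n \<Phi> L M c"
proof -
  have \<Phi>V: "(\<lambda>\<omega>. \<Phi> (V f \<omega>)) \<in> borel_measurable Q" if "f \<in> F" for f
    by (rule measurable_compose[OF V[OF that] \<Phi>])
  have 1: "(\<integral>\<omega>. (SUP f\<in>F. e f - \<Phi> (V f \<omega>)) \<partial>distr P Q q) = (\<integral>\<omega>. (SUP f\<in>F. e f - \<Phi> (V f (q \<omega>))) \<partial>P)"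
    by (rule integral_distr[OF q], rule borel_measurable_cSUP)
       (use F in \<open>auto intro: countable_finite borel_measurable_diff \<Phi>V\<close>)
  have 2: "(\<integral>\<omega>. gaussian_average n ((\<lambda>f. V f \<omega>) ` F) \<partial>distr P Q q)
      = (\<integral>\<omega>. gaussian_average n ((\<lambda>f. V f (q \<omega>)) ` F) \<partial>P)"
    by (rule integral_distr[OF q gaussian_average_measurable[OF F V]])
  have 3: "measure (distr P Q q) {\<omega>\<in>space (distr P Q q). \<forall>f\<in>F. e f \<le> \<Phi> (V f \<omega>) + b + b'}
     = measure P {\<omega>\<in>space P. \<forall>f\<in>F. e f \<le> \<Phi> (V f (q \<omega>)) + b + b'}" for b b'
  proof -
    have "{\<omega>\<in>space Q. \<forall>f\<in>F. e f \<le> \<Phi> (V f \<omega>) + b + b'} \<in> sets Q"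
      using F by (intro sets.sets_Collect_finite_All borel_measurable_le borel_measurable_add \<Phi>V) auto
    from measure_distr[OF q this] have
      "measure (distr P Q q) {\<omega>\<in>space (distr P Q q). \<forall>f\<in>F. e f \<le> \<Phi> (V f \<omega>) + b + b'}
       = measure P (q -` {\<omega>\<in>space Q. \<forall>f\<in>F. e f \<le> \<Phi> (V f \<omega>) + b + b'} \<inter> space P)" by simp
    also have "q -` {\<omega>\<in>space Q. \<forall>f\<in>F. e f \<le> \<Phi> (V f \<omega>) + b + b'} \<inter> space P
       = {\<omega>\<in>space P. \<forall>f\<in>F. e f \<le> \<Phi> (V f (q \<omega>)) + b + b'}"
      using measurable_space[OF q] by auto
    finally show ?thesis .
  qed
  show ?thesis unfolding deviation_bounds_def 1 2 3 ..
qed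

context smooth_function_of_class
begin

lemma deviation_abs_le:
  assumes x: "x \<in> space P"
  shows "\<bar>deviation x\<bar> \<le> L * n"
proof -
  obtain f where f: "f \<in> F" "deviation x = (\<integral>x'. \<Phi> (map_vec n f x') \<partial>P) - \<Phi> (map_vec n f x)"
    unfolding deviation_def by (rule SUP_finite_attained[OF F])
  note int = integrable_\<Phi>_map_vec[OF f(1)]
  have "deviation x = (\<integral>x'. \<Phi> (map_vec n f x') - \<Phi> (map_vec n f x) \<partial>P)"
    using Bochner_Integration.integral_diff[OF int P.integrable_const[of "\<Phi> (map_vec n f x)"]] P.prob_space
    unfolding f(2) by simp
  also have "\<bar>\<dots>\<bar> \<le> (\<integral>x'. \<bar>\<Phi> (map_vec n f x') - \<Phi> (map_vec n f x)\<bar> \<partial>P)" by (rule integral_abs_bound)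
  also have "\<dots> \<le> (\<integral>x'. L * n \<partial>P)"
    by (intro integral_mono integrable_abs Bochner_Integration.integrable_diff int P.integrable_const
        \<Phi>_map_vec_diff_le f(1) x)
  also have "\<dots> = L * n" using P.prob_space by simp
  finally show ?thesis .
qed

lemma deviation_bounded_difference:
  assumes i: "i \<in> {1..n}" and x: "x \<in> space P" and a: "a \<in> space (\<mu> i)"
  shows "\<bar>deviation (x(i := a)) - deviation x\<bar> \<le> L"
proof -
  have xa: "x(i := a) \<in> space P" using i x a by (auto simp: space_PiM PiE_def extensional_def)
  have le: "deviation u \<le> deviation v + L"
    if u: "u \<in> space P" and v: "v \<in> space P" and uv: "\<And>j. j \<noteq> i \<Longrightarrow> u j = v j" for u v
    unfolding deviation_def[of u]
  proof (rule cSUP_least[OF F(2)])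
    fix f assume f: "f \<in> F"
    have "\<bar>\<Phi> (map_vec n f v) - \<Phi> (map_vec n f u)\<bar> \<le> L * (\<Sum>j=1..n. \<bar>map_vec n f v j - map_vec n f u j\<bar>)"
      by (rule Lipschitz_Rn[OF td L map_vec_Rn map_vec_Rn])
    also have "\<dots> \<le> L * (\<Sum>j=1..n. if j = i then 1 else 0)"
    proof (intro mult_left_mono sum_mono L_nonneg)
      fix j assume j: "j \<in> {1..n}"
      show "\<bar>map_vec n f v j - map_vec n f u j\<bar> \<le> (if j = i then 1 else 0)"
        using map_vec_range[OF f u j] map_vec_range[OF f v j] uv[of j] by (auto simp: map_vec_def)
    qed
    also have "\<dots> = L" using i by simp
    finally show "(\<integral>x'. \<Phi> (map_vec n f x') \<partial>P) - \<Phi> (map_vec n f u) \<le> deviation v + L"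
      using SUP_finite_upper[OF F(1) f, of "\<lambda>f. (\<integral>x'. \<Phi> (map_vec n f x') \<partial>P) - \<Phi> (map_vec n f v)"]
      unfolding deviation_def by linarith
  qed
  show ?thesis using le[OF xa x] le[OF x xa] by fastforce
qed

text \<open>The bounded difference inequality with all constants equal to \<open>L\<close> needs \<open>L > 0\<close>; for \<open>L = 0\<close>
  the function \<open>\<Phi>\<close> is constant and the deviation vanishes.\<close>

lemma deviation_tail:
  assumes \<delta>: "0 < \<delta>"
  shows "1 - \<delta> \<le> measure P {x\<in>space P. deviation x \<le> (\<integral>x. deviation x \<partial>P) + L * sqrt (real n * ln (1 / \<delta>) / 2)}"
    (is "_ \<le> measure P ?E")
proof -
  let ?m = "\<integral>x. deviation x \<partial>P" and ?t = "L * sqrt (real n * ln (1 / \<delta>) / 2)"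
  have dm: "deviation \<in> borel_measurable P" using integrable_deviation by (rule borel_measurable_integrable)
  consider "\<delta> \<ge> 1" | "L = 0" | "\<delta> < 1" "L > 0" using L_nonneg by linarith
  then show ?thesis
  proof cases
    case 1
    then have "1 - \<delta> \<le> 0" by simp
    also have "0 \<le> measure P ?E" by simp
    finally show ?thesis .
  next
    case 2
    have "deviation x = 0" if "x \<in> space P" for x using deviation_abs_le[OF that] 2 by simp
    then have "?E = space P" using 2
      by (auto intro!: integral_nonneg_AE AE_I2)
    then show ?thesis using \<delta> P.prob_space by simp
  next
    case 3
    have ln: "ln (1 / \<delta>) > 0" using 3 \<delta> by simp
    have S: "(\<Sum>i\<in>{1..n}. L\<^sup>2) = n * L\<^sup>2" by simp
    have "measure P {x\<in>space P. deviation x \<ge> ?m + ?t} \<le> exp (- 2 * ?t\<^sup>2 / (\<Sum>i\<in>{1..n}. L\<^sup>2))"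
      by (rule bounded_differences_tail[OF _ _ dm deviation_abs_le deviation_bounded_difference])
         (use \<mu> 3 n ln in auto)
    also have "- 2 * ?t\<^sup>2 / (\<Sum>i\<in>{1..n}. L\<^sup>2) = - ln (1 / \<delta>)"
      unfolding S using 3 n ln by (simp add: power_mult_distrib)
    also have "exp (- ln (1 / \<delta>)) = \<delta>" using \<delta> by (simp add: ln_div)
    finally have le: "measure P {x\<in>space P. deviation x \<ge> ?m + ?t} \<le> \<delta>" .
    have "1 - \<delta> \<le> 1 - measure P {x\<in>space P. deviation x \<ge> ?m + ?t}" using le by simp
    also have "\<dots> = measure P (space P - {x\<in>space P. deviation x \<ge> ?m + ?t})"
      using dm by (intro P.prob_compl[symmetric]) measurable
    also have "\<dots> \<le> measure P ?E"
      using dm by (intro P.finite_measure_mono) (auto, measurable)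
    finally show ?thesis .
  qed
qed

lemma deviation_bounds_PiM:
  "deviation_bounds P F (map_vec n) (\<lambda>f. \<integral>x. \<Phi> (map_vec n f x) \<partial>P) n \<Phi> L M (2 * sqrt (3 * pi / 2))"
  unfolding deviation_bounds_def
proof (intro conjI allI impI)
  let ?c = "2 * sqrt (3 * pi / 2)"
  have avg: "(\<integral>x. gaussian_average n ((\<lambda>f. map_vec n f x) ` F) \<partial>P) = (\<integral>x. average x \<partial>P)"
    unfolding average_def class_image_def ..
  show E: "(\<integral>x. (SUP f\<in>F. (\<integral>x. \<Phi> (map_vec n f x) \<partial>P) - \<Phi> (map_vec n f x)) \<partial>P)
    \<le> ?c * (M + L) * (\<integral>x. gaussian_average n ((\<lambda>f. map_vec n f x) ` F) \<partial>P)"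
    using expectation_deviation_le unfolding avg deviation_def .
  fix \<delta> :: real assume \<delta>: "0 < \<delta>"
  let ?t = "L * sqrt (real n * ln (1 / \<delta>) / 2)"
  let ?T = "{x\<in>space P. \<forall>f\<in>F. (\<integral>x. \<Phi> (map_vec n f x) \<partial>P) \<le> \<Phi> (map_vec n f x)
       + ?c * (L + M) * (\<integral>x. gaussian_average n ((\<lambda>f. map_vec n f x) ` F) \<partial>P) + ?t}"
  note deviation_tail[OF \<delta>]
  also have "measure P {x\<in>space P. deviation x \<le> (\<integral>x. deviation x \<partial>P) + ?t} \<le> measure P ?T"
  proof (rule P.finite_measure_mono)
    show "?T \<in> sets P"
      using F(1) by (intro sets.sets_Collect_finite_All borel_measurable_le borel_measurable_add \<Phi>_map_vec_measurable) auto
    show "{x\<in>space P. deviation x \<le> (\<integral>x. deviation x \<partial>P) + ?t} \<subseteq> ?T"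
    proof safe
      fix x f assume x: "deviation x \<le> (\<integral>x. deviation x \<partial>P) + ?t" and f: "f \<in> F"
      have "(\<integral>x. \<Phi> (map_vec n f x) \<partial>P) - \<Phi> (map_vec n f x) \<le> deviation x"
        unfolding deviation_def by (rule SUP_finite_upper[OF F(1) f])
      also note x
      also note expectation_deviation_le
      finally show "(\<integral>x. \<Phi> (map_vec n f x) \<partial>P) \<le> \<Phi> (map_vec n f x)
         + ?c * (L + M) * (\<integral>x. gaussian_average n ((\<lambda>f. map_vec n f x) ` F) \<partial>P) + ?t"
        unfolding avg by (simp add: add.commute)
    qed
  qed
  finally show "1 - \<delta> \<le> measure P ?T" .
qed

end

section \<open>Arbitrary probability spaces\<close>

lemma (in prob_space) indep_copy_rv:
  assumes "independent_copy M S n X X'"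
  shows "(\<lambda>\<omega>. \<lambda>i\<in>{1..n}. X i \<omega>) \<in> measurable M (PiM {1..n} (\<lambda>_. S))"
    and "(\<lambda>\<omega>. \<lambda>i\<in>{1..n}. X' i \<omega>) \<in> measurable M (PiM {1..n} (\<lambda>_. S))"
  using assms unfolding independent_copy_def by (auto dest: indep_var_rv1 indep_var_rv2)

lemma map_vec_restrict: "map_vec n f (\<lambda>i\<in>{1..n}. x i) = map_vec n f x"
  by (auto simp: map_vec_def)

lemma uniform_bound_iff:
  "uniform_bound (W :: 'w itself) (T :: 'x itself) c \<longleftrightarrow>
     (\<forall>(P :: 'w measure) (S :: 'x measure) n X X' F \<Phi> L M.
        prob_space P \<longrightarrow> n \<ge> 1 \<longrightarrow> prob_space.indep_vars P (\<lambda>_. S) X {1..n} \<longrightarrow>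
        independent_copy P S n X X' \<longrightarrow> finite F \<longrightarrow> F \<noteq> {} \<longrightarrow>
        (\<forall>f\<in>F. f \<in> borel_measurable S \<and> (\<forall>x\<in>space S. f x \<in> {0..1})) \<longrightarrow>
        twice_differentiable_Rn n \<Phi> \<longrightarrow> first_order_bound n \<Phi> L \<longrightarrow> mixed_second_order_bound n \<Phi> M \<longrightarrow>
        deviation_bounds P F (\<lambda>f \<omega>. map_vec n f (\<lambda>i. X i \<omega>))
          (\<lambda>f. \<integral>\<omega>. \<Phi> (map_vec n f (\<lambda>i. X' i \<omega>)) \<partial>P) n \<Phi> L M c)"
  unfolding uniform_bound_def deviation_bounds_def class_image_def ..

text \<open>The law of \<open>X\<close> is the product of the laws of the \<open>X i\<close>, and \<open>X'\<close> enters only through its law,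
  which is the same.\<close>

lemma uniform_bound_universal: "uniform_bound TYPE('w) TYPE('x) (2 * sqrt (3 * pi / 2))"
  unfolding uniform_bound_iff
proof (intro allI impI)
  fix P :: "'w measure" and S :: "'x measure" and n :: nat and X X' :: "nat \<Rightarrow> 'w \<Rightarrow> 'x"
    and F :: "('x \<Rightarrow> real) set" and \<Phi> :: "(nat \<Rightarrow> real) \<Rightarrow> real" and L M :: real
  assume P: "prob_space P" and n: "n \<ge> 1" and ind: "prob_space.indep_vars P (\<lambda>_. S) X {1..n}"
    and copy: "independent_copy P S n X X'" and F: "finite F" "F \<noteq> {}"
    and f: "\<forall>f\<in>F. f \<in> borel_measurable S \<and> (\<forall>x\<in>space S. f x \<in> {0..1})"
    and td: "twice_differentiable_Rn n \<Phi>" and L: "first_order_bound n \<Phi> L"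
    and M: "mixed_second_order_bound n \<Phi> M"
  interpret W: prob_space P by fact
  let ?Q = "PiM {1..n} (\<lambda>_. S)"
  define q where "q \<omega> = (\<lambda>i\<in>{1..n}. X i \<omega>)" for \<omega>
  define q' where "q' \<omega> = (\<lambda>i\<in>{1..n}. X' i \<omega>)" for \<omega>
  have q: "q \<in> measurable P ?Q" and q': "q' \<in> measurable P ?Q"
    using W.indep_copy_rv[OF copy] unfolding q_def q'_def by auto
  have rv: "X i \<in> measurable P S" if "i \<in> {1..n}" for i
    using ind that unfolding W.indep_vars_def by auto
  define \<mu> where "\<mu> i = distr P S (X i)" for i
  have \<mu>: "prob_space (\<mu> i)" if "i \<in> {1..n}" for i
    unfolding \<mu>_def by (rule W.prob_space_distr[OF rv[OF that]])
  interpret smooth_function_of_class n \<mu> F \<Phi> L M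
    by (rule smooth_function_of_class.intro[OF n \<mu> F _ _ td L M]) (use f in \<open>auto simp: \<mu>_def\<close>)
  have law: "distr P ?Q q = PiM {1..n} \<mu>"
    using ind W.indep_vars_iff_distr_eq_PiM'[of "{1..n}" X "\<lambda>_. S"] rv n
    unfolding q_def \<mu>_def by auto
  have law': "distr P ?Q q' = PiM {1..n} \<mu>"
    using copy law unfolding independent_copy_def q_def q'_def by simp
  have \<Phi>: "\<Phi> \<in> borel_measurable (PiM {1..n} (\<lambda>_. borel))"
    by (rule Lipschitz_borel_measurable[OF Lipschitz_Rn[OF td L]])
  have mv: "map_vec n f \<in> measurable ?Q (PiM {1..n} (\<lambda>_. borel))" if "f \<in> F" for f
    using f that by (intro map_vec_measurable) auto
  have e: "(\<integral>x. \<Phi> (map_vec n f x) \<partial>PiM {1..n} \<mu>) = (\<integral>\<omega>. \<Phi> (map_vec n f (\<lambda>i. X' i \<omega>)) \<partial>P)"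
    if "f \<in> F" for f
  proof -
    have "(\<integral>x. \<Phi> (map_vec n f x) \<partial>distr P ?Q q') = (\<integral>\<omega>. \<Phi> (map_vec n f (q' \<omega>)) \<partial>P)"
      by (rule integral_distr[OF q' measurable_compose[OF mv[OF that] \<Phi>]])
    then show ?thesis unfolding law' by (simp add: q'_def map_vec_restrict[unfolded One_nat_def])
  qed
  have "deviation_bounds P F (\<lambda>f \<omega>. map_vec n f (q \<omega>)) (\<lambda>f. \<integral>x. \<Phi> (map_vec n f x) \<partial>PiM {1..n} \<mu>)
      n \<Phi> L M (2 * sqrt (3 * pi / 2))"
    using deviation_bounds_PiM unfolding law[symmetric]
    using deviation_bounds_distr[OF F(1) q mv \<Phi>] by simp
  then show "deviation_bounds P F (\<lambda>f \<omega>. map_vec n f (\<lambda>i. X i \<omega>))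
      (\<lambda>f. \<integral>\<omega>. \<Phi> (map_vec n f (\<lambda>i. X' i \<omega>)) \<partial>P) n \<Phi> L M (2 * sqrt (3 * pi / 2))"
    by (subst (asm) deviation_bounds_cong[where V' = "\<lambda>f \<omega>. map_vec n f (\<lambda>i. X i \<omega>)"
          and e' = "\<lambda>f. \<integral>\<omega>. \<Phi> (map_vec n f (\<lambda>i. X' i \<omega>)) \<partial>P"])
       (auto simp: e[unfolded One_nat_def] q_def map_vec_restrict[unfolded One_nat_def])
qed

lemma (in prob_space) indep_var_distr:
  assumes q: "q \<in> measurable M Q" and A: "A \<in> measurable Q S" and B: "B \<in> measurable Q T"
    and ind: "indep_var S (\<lambda>\<omega>. A (q \<omega>)) T (\<lambda>\<omega>. B (q \<omega>))"
  shows "prob_space.indep_var (distr M Q q) S A T B"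
proof -
  interpret D: prob_space "distr M Q q" by (rule prob_space_distr[OF q])
  have AB: "(\<lambda>x. (A x, B x)) \<in> measurable Q (S \<Otimes>\<^sub>M T)" using A B by (rule measurable_Pair)
  show ?thesis
    using ind A B unfolding D.indep_var_distribution_eq indep_var_distribution_eq
    by (simp add: distr_distr[OF A q] distr_distr[OF B q] distr_distr[OF AB q] comp_def)
qed

lemma (in prob_space) indep_vars_distr:
  assumes q: "q \<in> measurable M Q" and A: "\<And>i. i \<in> I \<Longrightarrow> A i \<in> measurable Q (S i)" and I: "I \<noteq> {}"
    and ind: "indep_vars S (\<lambda>i \<omega>. A i (q \<omega>)) I"
  shows "prob_space.indep_vars (distr M Q q) S A I"
proof -
  interpret D: prob_space "distr M Q q" by (rule prob_space_distr[OF q])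
  have AI: "(\<lambda>x. \<lambda>i\<in>I. A i x) \<in> measurable Q (PiM I S)" using A by (intro measurable_restrict)
  have Aq: "(\<lambda>\<omega>. A i (q \<omega>)) \<in> measurable M (S i)" if "i \<in> I" for i
    using measurable_compose[OF q A[OF that]] .
  have "PiM I (\<lambda>i. distr (distr M Q q) (S i) (A i)) = PiM I (\<lambda>i. distr M (S i) (\<lambda>\<omega>. A i (q \<omega>)))"
    by (intro PiM_cong refl) (simp add: distr_distr[OF A q] comp_def)
  also have "\<dots> = distr M (PiM I S) (\<lambda>\<omega>. \<lambda>i\<in>I. A i (q \<omega>))"
    using ind indep_vars_iff_distr_eq_PiM'[OF I Aq] by simp
  also have "\<dots> = distr (distr M Q q) (PiM I S) (\<lambda>x. \<lambda>i\<in>I. A i x)"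
    by (simp add: distr_distr[OF AI q] comp_def)
  finally show ?thesis using D.indep_vars_iff_distr_eq_PiM'[OF I, of A S] A by simp
qed

text \<open>Enumerate the class as \<open>h 0, \<dots>, h (m - 1)\<close> and replace each point \<open>x\<close> by the sequence \<open>emb x\<close>
  of its values under these functions, which then become the coordinate functions \<open>clip j\<close>; the
  clipping to \<open>[0, 1]\<close> has no effect on the range of \<open>emb\<close> but keeps the values of \<open>clip j\<close> in
  \<open>[0, 1]\<close> on the whole space. The sample point \<open>\<omega>\<close> is replaced by the sequence \<open>q \<omega>\<close> that codes
  the values of all \<open>X i\<close> (in the blocks \<open>1, \<dots>, n\<close>) and all \<open>X' i\<close> (in the blocks \<open>n + 1, \<dots>, 2
  n\<close>), so the image of \<open>P\<close> under \<open>q\<close> carries random variables \<open>Y i\<close> and \<open>Y' i\<close> with the same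
  joint law as \<open>emb (X i)\<close> and \<open>emb (X' i)\<close>.\<close>

lemma uniform_bound_transfer:
  assumes ub: "uniform_bound TYPE(nat \<Rightarrow> real) TYPE(nat \<Rightarrow> real) c"
  shows "uniform_bound TYPE('w) TYPE('x) c"
  unfolding uniform_bound_iff
proof (intro allI impI)
  fix P :: "'w measure" and S :: "'x measure" and n :: nat and X X' :: "nat \<Rightarrow> 'w \<Rightarrow> 'x"
    and F :: "('x \<Rightarrow> real) set" and \<Phi> :: "(nat \<Rightarrow> real) \<Rightarrow> real" and L M :: real
  assume P: "prob_space P" and n: "n \<ge> 1" and ind: "prob_space.indep_vars P (\<lambda>_. S) X {1..n}"
    and copy: "independent_copy P S n X X'" and F: "finite F" "F \<noteq> {}"
    and f: "\<forall>f\<in>F. f \<in> borel_measurable S \<and> (\<forall>x\<in>space S. f x \<in> {0..1})"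
    and td: "twice_differentiable_Rn n \<Phi>" and L: "first_order_bound n \<Phi> L"
    and M: "mixed_second_order_bound n \<Phi> M"
  interpret P: prob_space P by fact
  define R :: "(nat \<Rightarrow> real) measure" where "R = PiM UNIV (\<lambda>_. borel)"
  define m where "m = card F"
  obtain h where h: "bij_betw h {..<m} F"
    using F(1) unfolding m_def by (metis ex_bij_betw_nat_finite atLeast0LessThan)
  have hF: "h ` {..<m} = F" using h by (simp add: bij_betw_def)
  have m: "{..<m} \<noteq> {}" using hF F(2) by auto
  have hf: "h j \<in> borel_measurable S" "\<And>x. x \<in> space S \<Longrightarrow> h j x \<in> {0..1}" if "j < m" for j
    using f hF that by auto
  define emb where "emb x = (\<lambda>j. if j < m then h j x else 0)" for x
  have emb: "emb \<in> measurable S R"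
    unfolding R_def
  proof (rule measurable_PiM_single')
    fix j show "(\<lambda>x. emb x j) \<in> borel_measurable S"
      unfolding emb_def using hf by (cases "j < m") auto
  qed auto
  define embv where "embv x = (\<lambda>i\<in>{1..n}. emb (x i))" for x :: "nat \<Rightarrow> 'x"
  have embv: "embv \<in> measurable (PiM {1..n} (\<lambda>_. S)) (PiM {1..n} (\<lambda>_. R))"
    unfolding embv_def
    by (intro measurable_restrict measurable_compose[OF _ emb] measurable_component_singleton)
  have rvX: "X i \<in> measurable P S" if "i \<in> {1..n}" for i
    using ind that unfolding P.indep_vars_def by auto
  have rvX': "X' i \<in> measurable P S" if "i \<in> {1..n}" for i
    using measurable_compose[OF P.indep_copy_rv(2)[OF copy] measurable_component_singleton[OF that]] that by simp
  define clip where "clip j y = max 0 (min 1 (y j))" for j :: nat and y :: "nat \<Rightarrow> real"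
  have clip: "clip j \<in> borel_measurable R" for j
    unfolding clip_def R_def by measurable
  have clip_emb: "clip j (emb x) = h j x" if "j < m" "x \<in> space S" for j x
    using hf(2)[OF that] that(1) by (simp add: clip_def emb_def)
  define Z where "Z k \<omega> = (case prod_decode k of (i, j) \<Rightarrow>
    if i \<in> {1..n} then emb (X i \<omega>) j else if i - n \<in> {1..n} then emb (X' (i - n) \<omega>) j else 0)" for k \<omega>
  define q where "q \<omega> = (\<lambda>k. Z k \<omega>)" for \<omega>
  have embc: "(\<lambda>x. emb x j) \<in> borel_measurable S" for j
    using measurable_compose[OF emb[unfolded R_def] measurable_component_singleton[of j]] by simp
  have q: "q \<in> measurable P R"
    unfolding R_def
  proof (rule measurable_PiM_single')
    fix k
    obtain i j where ij: "prod_decode k = (i, j)" by fastforce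
    show "(\<lambda>\<omega>. q \<omega> k) \<in> borel_measurable P"
      unfolding q_def Z_def ij prod.case
      using measurable_compose[OF rvX embc, of i j] measurable_compose[OF rvX' embc, of "i - n" j]
      by (cases "i \<in> {1..n}"; cases "i - n \<in> {1..n}") (simp_all del: atLeastAtMost_iff One_nat_def)
  qed auto
  define Y where "Y i y = (\<lambda>j. y (prod_encode (i, j)))" for i and y :: "nat \<Rightarrow> real"
  define Y' where "Y' i y = (\<lambda>j. y (prod_encode (i + n, j)))" for i and y :: "nat \<Rightarrow> real"
  have Y: "Y i \<in> measurable R R" and Y': "Y' i \<in> measurable R R" for i
    unfolding Y_def Y'_def R_def by (rule measurable_PiM_single'; simp)+
  have Yq: "Y i (q \<omega>) = emb (X i \<omega>)" if "i \<in> {1..n}" for i \<omega>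
    using that by (simp add: Y_def q_def Z_def)
  have Y'q: "Y' i (q \<omega>) = emb (X' i \<omega>)" if "i \<in> {1..n}" for i \<omega>
    using that by (simp add: Y'_def q_def Z_def)
  let ?D = "distr P R q"
  interpret D: prob_space ?D by (rule P.prob_space_distr[OF q])
  have indY: "D.indep_vars (\<lambda>_. R) Y {1..n}"
  proof (rule P.indep_vars_distr[OF q Y])
    have "P.indep_vars (\<lambda>_. R) (\<lambda>i \<omega>. emb (X i \<omega>)) {1..n}"
      by (rule P.indep_vars_compose2[OF ind]) (rule emb)
    then show "P.indep_vars (\<lambda>_. R) (\<lambda>i \<omega>. Y i (q \<omega>)) {1..n}"
      by (rule iffD1[OF P.indep_vars_cong, rotated -1]) (auto simp: Yq)
  qed (use n in auto)
  let ?Y = "\<lambda>y. \<lambda>i\<in>{1..n}. Y i y" and ?Y' = "\<lambda>y. \<lambda>i\<in>{1..n}. Y' i y"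
  let ?X = "\<lambda>\<omega>. \<lambda>i\<in>{1..n}. X i \<omega>" and ?X' = "\<lambda>\<omega>. \<lambda>i\<in>{1..n}. X' i \<omega>"
  let ?SX = "PiM {1..n} (\<lambda>_. S)" and ?RX = "PiM {1..n} (\<lambda>_. R)"
  have YR: "?Y \<in> measurable R ?RX" and Y'R: "?Y' \<in> measurable R ?RX"
    using Y Y' by (auto intro!: measurable_restrict)
  have Yv: "?Y (q \<omega>) = embv (?X \<omega>)" and Y'v: "?Y' (q \<omega>) = embv (?X' \<omega>)" for \<omega>
    using Yq Y'q by (auto simp: embv_def fun_eq_iff)
  have copyY: "independent_copy ?D R n Y Y'"
    unfolding independent_copy_def
  proof
    have "P.indep_var ?RX (embv \<circ> ?X) ?RX (embv \<circ> ?X')"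
      using copy unfolding independent_copy_def by (intro P.indep_var_compose[OF _ embv embv]) auto
    then show "D.indep_var ?RX ?Y ?RX ?Y'"
      by (intro P.indep_var_distr[OF q YR Y'R]) (simp add: Yv Y'v comp_def del: One_nat_def)
    have "distr ?D ?RX ?Y' = distr (distr P ?SX ?X') ?RX embv"
      unfolding distr_distr[OF Y'R q] distr_distr[OF embv P.indep_copy_rv(2)[OF copy]]
      by (simp add: comp_def Y'v del: One_nat_def)
    also have "\<dots> = distr (distr P ?SX ?X) ?RX embv"
      using copy unfolding independent_copy_def by simp
    also have "\<dots> = distr ?D ?RX ?Y"
      unfolding distr_distr[OF YR q] distr_distr[OF embv P.indep_copy_rv(1)[OF copy]]
      by (simp add: comp_def Yv del: One_nat_def)
    finally show "distr ?D ?RX ?Y' = distr ?D ?RX ?Y" .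
  qed
  have clip01: "clip j y \<in> {0..1}" for j y by (auto simp: clip_def)
  have clipF: "\<forall>f\<in>clip ` {..<m}. f \<in> borel_measurable R \<and> (\<forall>x\<in>space R. f x \<in> {0..1})"
    using clip clip01 by blast
  have "deviation_bounds ?D (clip ` {..<m}) (\<lambda>f y. map_vec n f (\<lambda>i. Y i y))
      (\<lambda>f. \<integral>y. \<Phi> (map_vec n f (\<lambda>i. Y' i y)) \<partial>?D) n \<Phi> L M c"
    using ub[unfolded uniform_bound_iff, rule_format, OF D.prob_space_axioms n indY copyY _ _ clipF[rule_format] td L M] m
    by simp
  then have *: "deviation_bounds ?D {..<m} (\<lambda>j y. map_vec n (clip j) (\<lambda>i. Y i y))
      (\<lambda>j. \<integral>y. \<Phi> (map_vec n (clip j) (\<lambda>i. Y' i y)) \<partial>?D) n \<Phi> L M c"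
    unfolding deviation_bounds_image .
  have \<Phi>: "\<Phi> \<in> borel_measurable (PiM {1..n} (\<lambda>_. borel))"
    by (rule Lipschitz_borel_measurable[OF Lipschitz_Rn[OF td L]])
  have mv: "(\<lambda>y. map_vec n (clip j) (\<lambda>i. A i y)) \<in> measurable R (PiM {1..n} (\<lambda>_. borel))"
    if "\<And>i. A i \<in> measurable R R" for A j
    unfolding map_vec_def by (intro measurable_restrict measurable_compose[OF that clip])
  have eq: "map_vec n (clip j) (\<lambda>i. A i (q \<omega>)) = map_vec n (h j) (\<lambda>i. B i \<omega>)"
    if "j < m" "\<omega> \<in> space P" "\<And>i. i \<in> {1..n} \<Longrightarrow> B i \<in> measurable P S"
      "\<And>i. i \<in> {1..n} \<Longrightarrow> A i (q \<omega>) = emb (B i \<omega>)" for j \<omega> A B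
    unfolding map_vec_def
  proof (rule restrict_ext)
    fix i assume i: "i \<in> {1..n}"
    show "clip j (A i (q \<omega>)) = h j (B i \<omega>)"
      unfolding that(4)[OF i] by (rule clip_emb[OF that(1) measurable_space[OF that(3)[OF i] that(2)]])
  qed
  have e: "(\<integral>y. \<Phi> (map_vec n (clip j) (\<lambda>i. Y' i y)) \<partial>?D) = (\<integral>\<omega>. \<Phi> (map_vec n (h j) (\<lambda>i. X' i \<omega>)) \<partial>P)"
    if j: "j < m" for j
  proof -
    have "(\<integral>y. \<Phi> (map_vec n (clip j) (\<lambda>i. Y' i y)) \<partial>?D) = (\<integral>\<omega>. \<Phi> (map_vec n (clip j) (\<lambda>i. Y' i (q \<omega>))) \<partial>P)"
      by (rule integral_distr[OF q measurable_compose[OF mv[OF Y'] \<Phi>]])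
    also have "\<dots> = (\<integral>\<omega>. \<Phi> (map_vec n (h j) (\<lambda>i. X' i \<omega>)) \<partial>P)"
      by (intro Bochner_Integration.integral_cong refl arg_cong[of _ _ \<Phi>] eq j rvX' Y'q)
    finally show ?thesis .
  qed
  have "deviation_bounds P {..<m} (\<lambda>j \<omega>. map_vec n (clip j) (\<lambda>i. Y i (q \<omega>)))
      (\<lambda>j. \<integral>y. \<Phi> (map_vec n (clip j) (\<lambda>i. Y' i y)) \<partial>?D) n \<Phi> L M c"
    by (rule iffD1[OF deviation_bounds_distr[where V = "\<lambda>j y. map_vec n (clip j) (\<lambda>i. Y i y)",
            OF finite_lessThan q mv[OF Y] \<Phi>] *])
  also have "?this \<longleftrightarrow> deviation_bounds P {..<m} (\<lambda>j \<omega>. map_vec n (h j) (\<lambda>i. X i \<omega>))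
      (\<lambda>j. \<integral>\<omega>. \<Phi> (map_vec n (h j) (\<lambda>i. X' i \<omega>)) \<partial>P) n \<Phi> L M c"
    by (intro deviation_bounds_cong) (use e eq rvX Yq in auto)
  also have "\<dots> \<longleftrightarrow> deviation_bounds P F (\<lambda>f \<omega>. map_vec n f (\<lambda>i. X i \<omega>))
      (\<lambda>f. \<integral>\<omega>. \<Phi> (map_vec n f (\<lambda>i. X' i \<omega>)) \<partial>P) n \<Phi> L M c"
    unfolding hF[symmetric] deviation_bounds_image ..
  finally show "deviation_bounds P F (\<lambda>f \<omega>. map_vec n f (\<lambda>i. X i \<omega>))
      (\<lambda>f. \<integral>\<omega>. \<Phi> (map_vec n f (\<lambda>i. X' i \<omega>)) \<partial>P) n \<Phi> L M c" .
qed

theorem theorem1: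
  shows "(\<exists>c>0. uniform_bound TYPE(nat \<Rightarrow> real) TYPE(nat \<Rightarrow> real) c) \<and>
         (\<forall>c>0. uniform_bound TYPE(nat \<Rightarrow> real) TYPE(nat \<Rightarrow> real) c \<longrightarrow>
                uniform_bound TYPE('w) TYPE('x) c)"
proof (intro conjI allI impI)
  show "\<exists>c>0. uniform_bound TYPE(nat \<Rightarrow> real) TYPE(nat \<Rightarrow> real) c"
    using uniform_bound_universal by (intro exI[of _ "2 * sqrt (3 * pi / 2)"]) auto
qed (rule uniform_bound_transfer)

end
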